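(* Let $d\ge1$ and let $\Delta$ be a $d$-dimensional simplicial complex with $f_d(\Delta)=s$ and $H_d(\Delta;\mathbb{Z})=0$. Then the symmetric homology polytope $\mathcal{P}_\Delta$ is reflexive if and only if one of the following holds: (1) $H_{d-1}(\Delta;\mathbb{Z})=0$; (2) $d$ is even and $H_{d-1}(\Delta;\mathbb{Z})\cong\mathbb{Z}^\ell\oplus\mathbb{Z}_2\oplus\dots\oplus\mathbb{Z}_2$ for some $\ell\in\mathbb{N}$; (3) $d$ is odd, $H_{d-1}(\Delta;\mathbb{Z})\cong\mathbb{Z}^\ell\oplus\mathbb{Z}_2\oplus\dots\oplus\mathbb{Z}_2$ (with $r$ copies of $\mathbb{Z}_2$) for some $\ell\in\mathbb{N}$, and there exist $\mathbf{v}_{\Delta,1},\dots,\mathbf{v}_{\Delta,r}\in\{\pm\tfrac12,0\}^s\setminus\{\mathbf{0}\}$, each having an even number of nonzero entries, such that the classes $\partial_d\mathbf{v}_{\Delta,1}+\operatorname{im}_{\mathbb{Z}}\partial_d,\dots,\partial_d\mathbf{v}_{\Delta,r}+\operatorname{im}_{\mathbb{Z}}\partial_d$ generate the torsion subgroup of $H_{d-1}(\Delta;\mathbb{Z})$.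
   Context: For $j\ge1$ the boundary map $\partial_j$ of a simplicial complex on $[n]$ sends $\{i_1<\dots<i_{j+1}\}$ to $\sum_k(-1)^{k+1}(\sigma\setminus\{i_k\})$, identified with its integer matrix; $H_j(\Delta;\mathbb{Z})=\ker_{\mathbb{Z}}\partial_j/\operatorname{im}_{\mathbb{Z}}\partial_{j+1}$. $f_d(\Delta)$ is the number of $d$-faces, and $\mathbb{Z}^s$ is identified with $d$-chains. $\mathcal{P}_\Delta=\operatorname{conv}$ of the columns of $\partial_d$ and $-\partial_d$ for $d=\dim\Delta$. In (3), $\partial_d\mathbf{v}_{\Delta,i}$ is required to be an integral vector, hence a $(d-1)$-cycle, and its class modulo $\operatorname{im}_{\mathbb{Z}}\partial_d$ lies in $H_{d-1}(\Delta;\mathbb{Z})$. A centrally symmetric lattice polytope $P\subseteq\mathbb{R}^m$ is reflexive if for every facet $\mathcal{F}$ of $P$ there is $\mathbf{w}\in\mathbb{Z}^m$ with $P\subseteq\{\mathbf{w}^\top\mathbf{x}\le1\}$ and $\mathcal{F}=P\cap\{\mathbf{w}^\top\mathbf{x}=1\}$. *)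

theory Defs
  imports "HOL-Analysis.Analysis" "HOL-Algebra.Algebra"
begin

text \<open>
  Not every point of \<open>{1..n}\<close> is required to be a vertex. The empty face belongs to
  every complex, so that the dimension is a maximum over a nonempty finite set.
\<close>

definition abstract_simplicial_complex :: "nat \<Rightarrow> nat set set \<Rightarrow> bool" where
  "abstract_simplicial_complex n \<Delta> \<longleftrightarrow>
     \<Delta> \<subseteq> Pow {1..n} \<and> {} \<in> \<Delta> \<and> (\<forall>\<sigma>\<in>\<Delta>. \<forall>\<tau>\<subseteq>\<sigma>. \<tau> \<in> \<Delta>)"

definition complex_dim :: "nat set set \<Rightarrow> int" where
  "complex_dim \<Delta> = int (Max (card ` \<Delta>)) - 1"

definition faces :: "nat set set \<Rightarrow> nat \<Rightarrow> nat set set" where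
  "faces \<Delta> j = {\<sigma> \<in> \<Delta>. card \<sigma> = j + 1}"

text \<open>
  The entry in row \<open>\<tau>\<close> and column \<open>\<sigma>\<close> of a boundary matrix. The vertices of \<open>\<sigma>\<close> are
  numbered from 0 here, so the sign of the summand \<open>\<sigma> - {i\<^sub>k}\<close> is \<open>(-1)^k\<close>
  instead of \<open>(-1)^(k+1)\<close>.
\<close>

definition incidence :: "nat set \<Rightarrow> nat set \<Rightarrow> int" where
  "incidence \<tau> \<sigma> =
     (\<Sum>k<card \<sigma>. if \<tau> = \<sigma> - {sorted_list_of_set \<sigma> ! k} then (-1) ^ k else 0)"

definition chain_group :: "nat set set \<Rightarrow> nat \<Rightarrow> (nat set \<Rightarrow> int) monoid" where
  "chain_group \<Delta> j = product_group (faces \<Delta> j) (\<lambda>_. integer_group)"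

text \<open>
  Multiplication by the matrix of \<open>\<partial>\<^sub>j\<close>, meaningful for \<open>j \<ge> 1\<close> only. The coefficients
  are arbitrary because the map is applied to integral chains and to real vectors.
\<close>

definition boundary ::
    "nat set set \<Rightarrow> nat \<Rightarrow> (nat set \<Rightarrow> 'a::comm_ring_1) \<Rightarrow> nat set \<Rightarrow> 'a" where
  "boundary \<Delta> j c =
     (\<lambda>\<tau>\<in>faces \<Delta> (j - 1). \<Sum>\<sigma>\<in>faces \<Delta> j. of_int (incidence \<tau> \<sigma>) * c \<sigma>)"

text \<open>
  Homology is not reduced: \<open>\<partial>\<^sub>0\<close> is the zero map, so every 0-chain is a cycle.
\<close>

definition cycles :: "nat set set \<Rightarrow> nat \<Rightarrow> (nat set \<Rightarrow> int) set" where
  "cycles \<Delta> j =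
     (if j = 0 then carrier (chain_group \<Delta> 0)
      else kernel (chain_group \<Delta> j) (chain_group \<Delta> (j - 1)) (boundary \<Delta> j))"

definition cycle_group :: "nat set set \<Rightarrow> nat \<Rightarrow> (nat set \<Rightarrow> int) monoid" where
  "cycle_group \<Delta> j = (chain_group \<Delta> j)\<lparr>carrier := cycles \<Delta> j\<rparr>"

definition boundaries :: "nat set set \<Rightarrow> nat \<Rightarrow> (nat set \<Rightarrow> int) set" where
  "boundaries \<Delta> j = boundary \<Delta> (j + 1) ` carrier (chain_group \<Delta> (j + 1))"

definition homology :: "nat set set \<Rightarrow> nat \<Rightarrow> (nat set \<Rightarrow> int) set monoid" where
  "homology \<Delta> j = cycle_group \<Delta> j Mod boundaries \<Delta> j"

definition homology_class :: "nat set set \<Rightarrow> nat \<Rightarrow> (nat set \<Rightarrow> int) \<Rightarrow> (nat set \<Rightarrow> int) set" where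
  "homology_class \<Delta> j z = boundaries \<Delta> j #>\<^bsub>cycle_group \<Delta> j\<^esub> z"

definition torsion_part :: "('a, 'b) monoid_scheme \<Rightarrow> 'a set" where
  "torsion_part G = {x \<in> carrier G. \<exists>k::nat. 0 < k \<and> x [^]\<^bsub>G\<^esub> k = \<one>\<^bsub>G\<^esub>}"

text \<open>The group \<open>\<int>\<^sup>l \<oplus> \<int>\<^sub>2 \<oplus> \<dots> \<oplus> \<int>\<^sub>2\<close> with \<open>r\<close> summands \<open>\<int>\<^sub>2\<close>; both \<open>l\<close> and \<open>r\<close> may be 0.\<close>

definition free_plus_Z2 :: "nat \<Rightarrow> nat \<Rightarrow> ((nat \<Rightarrow> int) \<times> (nat \<Rightarrow> int)) monoid" where
  "free_plus_Z2 l r =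
     product_group {..<l} (\<lambda>_. integer_group) \<times>\<times>
     product_group {..<r} (\<lambda>_. integer_mod_group 2)"

definition integral_vector :: "real ^ 'm \<Rightarrow> bool" where
  "integral_vector w \<longleftrightarrow> (\<forall>i. w $ i \<in> \<int>)"

definition lattice_polytope :: "(real ^ 'm::finite) set \<Rightarrow> bool" where
  "lattice_polytope P \<longleftrightarrow>
     (\<exists>V. finite V \<and> (\<forall>v\<in>V. integral_vector v) \<and> P = convex hull V)"

definition centrally_symmetric :: "(real ^ 'm::finite) set \<Rightarrow> bool" where
  "centrally_symmetric P \<longleftrightarrow> uminus ` P = P"

text \<open>
  The polytope need not be full-dimensional: \<open>facet_of\<close> is relative to the affine hull.
\<close>

definition reflexive :: "(real ^ 'm::finite) set \<Rightarrow> bool" where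
  "reflexive P \<longleftrightarrow>
     lattice_polytope P \<and> centrally_symmetric P \<and>
     (\<forall>F. F facet_of P \<longrightarrow>
        (\<exists>w. integral_vector w \<and> P \<subseteq> {x. w \<bullet> x \<le> 1} \<and> F = P \<inter> {x. w \<bullet> x = 1}))"

text \<open>
  To place the columns of \<open>\<partial>\<^sub>d\<close> in \<open>real ^ 'm\<close>, the rows are numbered by a bijection
  \<open>\<rho>\<close> from \<open>'m\<close> onto the \<open>(d-1)\<close>-faces.
\<close>

definition boundary_column :: "('m \<Rightarrow> nat set) \<Rightarrow> nat set \<Rightarrow> real ^ 'm::finite" where
  "boundary_column \<rho> \<sigma> = (\<chi> i. real_of_int (incidence (\<rho> i) \<sigma>))"

definition symmetric_homology_polytope ::
    "('m \<Rightarrow> nat set) \<Rightarrow> nat set set \<Rightarrow> (real ^ 'm::finite) set" where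
  "symmetric_homology_polytope \<rho> \<Delta> =
     convex hull (let A = boundary_column \<rho> ` faces \<Delta> (nat (complex_dim \<Delta>))
                  in A \<union> uminus ` A)"

end

theory Submission
  imports Defs
begin

text \<open>
  Since \<open>H\<^sub>d = 0\<close>, the columns of \<open>\<partial>\<^sub>d\<close> are linearly independent over the integers, hence over the
  reals by simultaneous Diophantine approximation. So the polytope is a cross-polytope, its facets
  correspond to sign vectors \<open>\<epsilon>\<close>, and reflexivity says that every \<open>\<epsilon>\<close> lies in the lattice \<open>L\<close>
  spanned by the rows of \<open>\<partial>\<^sub>d\<close>. The dual lattice of \<open>L\<close> consists of the \<open>v\<close> with \<open>\<partial>\<^sub>d v\<close> integral,
  and modulo integral vectors it is the torsion of \<open>H\<^bsub>d-1\<^esub>\<close>. By duality reflexivity therefore means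
  that every such \<open>v\<close> has half-integral entries (all torsion is killed by 2) and integral coordinate
  sum. The second condition is automatic for even \<open>d\<close>, because then each column of \<open>\<partial>\<^sub>d\<close> has
  coordinate sum 1.
\<close>

section \<open>Incidence numbers\<close>

text \<open>Flipping one entry of a sign vector changes its pairing with \<open>v\<close> by twice
  an entry of \<open>v\<close>. Hence \<open>v\<close> pairs integrally with all sign vectors
  exactly when every \<open>2 * v \<sigma>\<close> and the sum of \<open>v\<close> are integral.
  Modulo integral vectors such a \<open>v\<close> has entries \<open>0\<close> and
  \<open>1/2\<close>, and its sum is integral exactly when the number of halves is even: this is the
  parity in (3). The sum modulo the integers is additive, so it only has to be tested on generators
  of the torsion. The passage to torsion rests on two facts. A rational \<open>v\<close> has an
  integral multiple \<open>k v\<close>, so \<open>k\<close> times the integral chain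
  \<open>\<partial> v\<close> is a boundary, and a chain with a nonzero multiple among the cycles is
  a cycle. Conversely, independence of the columns recovers \<open>v\<close> from
  \<open>\<partial> v\<close>. About the group structure, reflexivity only says that torsion is
  killed by 2, while the theorem asks for explicit summands. The structure theorem is therefore
  proved directly for this exponent, on pairs \<open>B \<subseteq> Z\<close> of subgroups of a real
  vector space, and its generators are lifted back to cycles.\<close>

lemma sum_antisymmetric_zero:
  fixes g :: "'a \<Rightarrow> 'a \<Rightarrow> int"
  assumes "\<And>x y. x \<in> S \<Longrightarrow> y \<in> S \<Longrightarrow> g y x = - g x y"
  shows "(\<Sum>x\<in>S. \<Sum>y\<in>S. g x y) = 0"
proof -
  have "(\<Sum>x\<in>S. \<Sum>y\<in>S. g x y) = (\<Sum>y\<in>S. \<Sum>x\<in>S. g x y)"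
    by (rule sum.swap)
  also have "\<dots> = (\<Sum>y\<in>S. \<Sum>x\<in>S. - g y x)"
    by (intro sum.cong refl assms)
  also have "\<dots> = - (\<Sum>x\<in>S. \<Sum>y\<in>S. g x y)"
    by (simp add: sum_negf)
  finally show ?thesis by simp
qed

lemma card_less_nth_sorted_list_of_set:
  fixes S :: "nat set"
  assumes "finite S" "k < card S"
  shows "card {y \<in> S. y < sorted_list_of_set S ! k} = k"
proof -
  let ?xs = "sorted_list_of_set S"
  have len: "length ?xs = card S" and dist: "distinct ?xs" and set: "set ?xs = S"
    using assms by auto
  have less: "?xs ! i < ?xs ! j \<longleftrightarrow> i < j" if "i < card S" "j < card S" for i j
  proof -
    have "sorted_wrt (<) ?xs" by simp
    then show ?thesis
      using that len by (metis linorder_neqE_nat not_less_iff_gr_or_eq sorted_wrt_iff_nth_less)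
  qed
  have "{y \<in> S. y < ?xs ! k} = (!) ?xs ` {..<k}"
  proof (intro equalityI subsetI)
    fix y assume "y \<in> {y \<in> S. y < ?xs ! k}"
    then obtain i where "i < card S" "y = ?xs ! i" "y < ?xs ! k"
      using set len by (metis (mono_tags, lifting) in_set_conv_nth mem_Collect_eq)
    then show "y \<in> (!) ?xs ` {..<k}" using less assms by auto
  next
    fix y assume "y \<in> (!) ?xs ` {..<k}"
    then obtain i where i: "i < k" "y = ?xs ! i" by auto
    then have "?xs ! i \<in> set ?xs" using assms len by (intro nth_mem) auto
    then show "y \<in> {y \<in> S. y < ?xs ! k}" using i less assms set by auto
  qed
  moreover have "inj_on ((!) ?xs) {..<k}"
    using dist len assms by (auto simp: inj_on_def nth_eq_iff_index_eq)
  ultimately show ?thesis by (simp add: card_image)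
qed

text \<open>Counting the smaller vertices replaces the position in a sorted list; this form of the
  sign can be compared between \<open>\<sigma>\<close> and \<open>\<sigma> - {x}\<close>.\<close>

lemma incidence_eq_sum:
  assumes "finite \<sigma>"
  shows "incidence \<tau> \<sigma> =
    (\<Sum>x\<in>\<sigma>. if \<tau> = \<sigma> - {x} then (-1) ^ card {y \<in> \<sigma>. y < x} else 0)"
proof -
  let ?xs = "sorted_list_of_set \<sigma>"
  have bij: "bij_betw ((!) ?xs) {..<card \<sigma>} \<sigma>"
    using assms by (intro bij_betw_nth) auto
  have "incidence \<tau> \<sigma> = (\<Sum>k<card \<sigma>. (\<lambda>x. if \<tau> = \<sigma> - {x} then (-1) ^ card {y \<in> \<sigma>. y < x} else 0) (?xs ! k))"
    unfolding incidence_def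
    by (intro sum.cong refl) (simp add: card_less_nth_sorted_list_of_set assms)
  also have "\<dots> = (\<Sum>x\<in>\<sigma>. if \<tau> = \<sigma> - {x} then (-1) ^ card {y \<in> \<sigma>. y < x} else 0)"
    by (rule sum.reindex_bij_betw[OF bij])
  finally show ?thesis .
qed

text \<open>The weight \<open>h\<close> is arbitrary because the sum is used twice: with a second
  incidence number for \<open>\<partial>\<partial> = 0\<close>, and with the constant 1 for the sum
  of a column.\<close>

lemma sum_incidence:
  assumes "finite \<sigma>" "finite E" "\<And>x. x \<in> \<sigma> \<Longrightarrow> \<sigma> - {x} \<in> E"
  shows "(\<Sum>\<tau>\<in>E. incidence \<tau> \<sigma> * h \<tau>) = (\<Sum>x\<in>\<sigma>. (-1) ^ card {y \<in> \<sigma>. y < x} * h (\<sigma> - {x}))"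
proof -
  have "(\<Sum>\<tau>\<in>E. incidence \<tau> \<sigma> * h \<tau>) =
      (\<Sum>\<tau>\<in>E. \<Sum>x\<in>\<sigma>. if \<tau> = \<sigma> - {x} then (-1) ^ card {y \<in> \<sigma>. y < x} * h \<tau> else 0)"
    by (simp add: incidence_eq_sum assms(1) sum_distrib_right if_distrib[of "\<lambda>t. t * h _"] cong: if_cong)
  also have "\<dots> = (\<Sum>x\<in>\<sigma>. \<Sum>\<tau>\<in>E. if \<tau> = \<sigma> - {x} then (-1) ^ card {y \<in> \<sigma>. y < x} * h \<tau> else 0)"
    by (rule sum.swap)
  also have "\<dots> = (\<Sum>x\<in>\<sigma>. (-1) ^ card {y \<in> \<sigma>. y < x} * h (\<sigma> - {x}))"
    using assms by (intro sum.cong refl) simp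
  finally show ?thesis .
qed

text \<open>Deleting two vertices in either order gives the same face with opposite signs: the
  position of the smaller vertex is unaffected, that of the larger one drops by one when the smaller
  is deleted first.\<close>

lemma incidence_incidence:
  assumes "finite \<sigma>" "finite E" "\<And>x. x \<in> \<sigma> \<Longrightarrow> \<sigma> - {x} \<in> E"
  shows "(\<Sum>\<tau>\<in>E. incidence \<tau> \<sigma> * incidence \<omega> \<tau>) = 0"
proof -
  define pos where "pos A x = card {y \<in> A. y < x}" for A and x :: nat
  \<comment> \<open>The condition \<open>x \<noteq> y\<close> makes the diagonal vanish, so that
    \<open>g\<close> is antisymmetric on all of \<open>\<sigma>\<close> and not only on pairs of
    distinct vertices.\<close>
  define g where "g x y = (if x \<noteq> y \<and> \<omega> = \<sigma> - {x} - {y}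
      then (-1) ^ pos \<sigma> x * (-1) ^ pos (\<sigma> - {x}) y else 0 :: int)" for x y
  have "(\<Sum>\<tau>\<in>E. incidence \<tau> \<sigma> * incidence \<omega> \<tau>) = (\<Sum>x\<in>\<sigma>. (-1) ^ pos \<sigma> x * incidence \<omega> (\<sigma> - {x}))"
    unfolding pos_def by (rule sum_incidence[OF assms])
  also have "\<dots> = (\<Sum>x\<in>\<sigma>. \<Sum>y\<in>\<sigma>. g x y)"
  proof (intro sum.cong refl)
    fix x assume "x \<in> \<sigma>"
    have "(-1) ^ pos \<sigma> x * incidence \<omega> (\<sigma> - {x}) = (\<Sum>y\<in>\<sigma> - {x}. g x y)"
      unfolding incidence_eq_sum[OF finite_Diff[OF assms(1)]] sum_distrib_left pos_def[symmetric]
      by (intro sum.cong refl) (auto simp only: g_def split: if_splits)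
    also have "\<dots> = (\<Sum>y\<in>\<sigma>. g x y)"
      using assms(1) by (intro sum.mono_neutral_left) (auto simp: g_def)
    finally show "(-1) ^ pos \<sigma> x * incidence \<omega> (\<sigma> - {x}) = (\<Sum>y\<in>\<sigma>. g x y)" .
  qed
  also have "\<dots> = 0"
  proof (rule sum_antisymmetric_zero)
    have less: "g y x = - g x y" if "x \<in> \<sigma>" "y \<in> \<sigma>" "x < y" for x y
    proof -
      have "{z \<in> \<sigma> - {y}. z < x} = {z \<in> \<sigma>. z < x}" using that by auto
      then have 1: "pos (\<sigma> - {y}) x = pos \<sigma> x" by (simp add: pos_def)
      have "{z \<in> \<sigma>. z < y} = insert x {z \<in> \<sigma> - {x}. z < y}" using that by auto
      then have 2: "pos \<sigma> y = Suc (pos (\<sigma> - {x}) y)" using assms(1) by (simp add: pos_def)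
      show ?thesis using that by (auto simp: g_def 1 2 insert_commute Diff_insert2[symmetric])
    qed
    show "g y x = - g x y" if "x \<in> \<sigma>" "y \<in> \<sigma>" for x y
      using less[OF that] less[OF that(2,1)] by (cases x y rule: linorder_cases) (auto simp: g_def)
  qed
  finally show ?thesis .
qed

text \<open>The nonzero entries of a column are the alternating signs 1, -1, ..., and for even
  \<open>d\<close> there is an odd number \<open>d + 1\<close> of them.\<close>

lemma sum_incidence_even:
  assumes "finite \<sigma>" "finite E" "\<And>x. x \<in> \<sigma> \<Longrightarrow> \<sigma> - {x} \<in> E" "card \<sigma> = d + 1" "even d"
  shows "(\<Sum>\<tau>\<in>E. incidence \<tau> \<sigma>) = 1"
proof -
  have alt: "(\<Sum>k<m. (-1::int) ^ k) = (if even m then 0 else 1)" for m :: nat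
    by (induction m) auto
  have bij: "bij_betw ((!) (sorted_list_of_set \<sigma>)) {..<card \<sigma>} \<sigma>"
    using assms by (intro bij_betw_nth) auto
  have "(\<Sum>\<tau>\<in>E. incidence \<tau> \<sigma>) = (\<Sum>x\<in>\<sigma>. (-1) ^ card {y \<in> \<sigma>. y < x})"
    using sum_incidence[OF assms(1-3), of "\<lambda>_. 1"] by simp
  also have "\<dots> = (\<Sum>k<card \<sigma>. (-1) ^ card {y \<in> \<sigma>. y < sorted_list_of_set \<sigma> ! k})"
    by (rule sum.reindex_bij_betw[OF bij, symmetric])
  also have "\<dots> = (\<Sum>k<card \<sigma>. (-1) ^ k)"
    by (intro sum.cong refl) (simp add: card_less_nth_sorted_list_of_set assms)
  finally show ?thesis using assms(4,5) by (simp only: alt) simp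
qed

section \<open>Integer lattices\<close>

text \<open>Normalise a real relation to have entry 1 at \<open>\<sigma>\<close> and approximate a
  multiple \<open>q * e\<close> of it by an integer vector \<open>P\<close>. Applying the matrix to
  \<open>P\<close> gives integers of absolute value below 1, so \<open>P\<close> lies in the integer
  kernel and vanishes, although \<open>P \<sigma>\<close> is close to
  \<open>q \<ge> 1\<close>.\<close>

lemma integer_kernel_imp_real_kernel:
  fixes A :: "'e \<Rightarrow> 'b \<Rightarrow> int" and c :: "'b \<Rightarrow> real"
  assumes fin: "finite D" "finite E"
    and ker: "\<And>p :: 'b \<Rightarrow> int. (\<And>\<tau>. \<tau> \<in> E \<Longrightarrow> (\<Sum>\<sigma>\<in>D. A \<tau> \<sigma> * p \<sigma>) = 0) \<Longrightarrow> (\<forall>\<sigma>\<in>D. p \<sigma> = 0)"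
    and c: "\<And>\<tau>. \<tau> \<in> E \<Longrightarrow> (\<Sum>\<sigma>\<in>D. of_int (A \<tau> \<sigma>) * c \<sigma>) = 0"
    and \<sigma>: "\<sigma> \<in> D"
  shows "c \<sigma> = 0"
proof (rule ccontr)
  assume nz: "c \<sigma> \<noteq> 0"
  define e where "e \<sigma>' = c \<sigma>' / c \<sigma>" for \<sigma>'
  have e: "(\<Sum>\<sigma>\<in>D. of_int (A \<tau> \<sigma>) * e \<sigma>) = 0" if "\<tau> \<in> E" for \<tau>
    using c[OF that] nz by (simp add: e_def sum_divide_distrib[symmetric])
  obtain h where h: "bij_betw h {..<card D} D"
    using ex_bij_betw_nat_finite[OF fin(1)] by (metis atLeast0LessThan)
  \<comment> \<open>\<open>N\<close> exceeds the absolute sum of every row, so errors below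
    \<open>1 / N\<close> stay below 1 after multiplication by the matrix; the summand 1 keeps
    \<open>N\<close> positive.\<close>
  define N where "N = nat (1 + (\<Sum>\<tau>\<in>E. \<Sum>\<sigma>\<in>D. \<bar>A \<tau> \<sigma>\<bar>))"
  have s0: "0 \<le> (\<Sum>\<tau>\<in>E. \<Sum>\<sigma>\<in>D. \<bar>A \<tau> \<sigma>\<bar>)" by (intro sum_nonneg) auto
  then have "N > 0" by (simp add: N_def)
  then obtain q p where q: "0 < q"
    and p: "\<And>i. i < card D \<Longrightarrow> \<bar>of_int q * e (h i) - of_int (p i)\<bar> < 1 / N"
    by (rule Dirichlet_approx_simult[where \<theta> = "\<lambda>i. e (h i)" and n = "card D"]) blast
  define P where "P \<sigma>' = p (inv_into {..<card D} h \<sigma>')" for \<sigma>'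
  have P: "\<bar>of_int q * e \<sigma>' - of_int (P \<sigma>')\<bar> < 1 / N" if "\<sigma>' \<in> D" for \<sigma>'
  proof -
    have "inv_into {..<card D} h \<sigma>' < card D" "h (inv_into {..<card D} h \<sigma>') = \<sigma>'"
      using h that by (auto simp: bij_betw_def f_inv_into_f inv_into_into[of _ h "{..<card D}", simplified])
    then show ?thesis using p by (metis P_def)
  qed
  have "\<forall>\<sigma>\<in>D. P \<sigma> = 0"
  proof (rule ker)
    fix \<tau> assume \<tau>: "\<tau> \<in> E"
    let ?S = "\<Sum>\<sigma>\<in>D. A \<tau> \<sigma> * P \<sigma>"
    have "real_of_int ?S = (\<Sum>\<sigma>\<in>D. of_int (A \<tau> \<sigma>) * (of_int (P \<sigma>) - of_int q * e \<sigma>)) + of_int q * (\<Sum>\<sigma>\<in>D. of_int (A \<tau> \<sigma>) * e \<sigma>)"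
      by (simp add: sum_distrib_left algebra_simps flip: sum.distrib)
    then have "\<bar>real_of_int ?S\<bar> \<le> (\<Sum>\<sigma>\<in>D. \<bar>of_int (A \<tau> \<sigma>) * (of_int (P \<sigma>) - of_int q * e \<sigma>)\<bar>)"
      using e[OF \<tau>] by (simp add: sum_abs)
    also have "\<dots> \<le> (\<Sum>\<sigma>\<in>D. of_int \<bar>A \<tau> \<sigma>\<bar> * (1 / N))"
      unfolding abs_mult of_int_abs
      by (intro sum_mono mult_left_mono) (use P in \<open>auto simp: abs_minus_commute intro: less_imp_le\<close>)
    also have "\<dots> = of_int (\<Sum>\<sigma>\<in>D. \<bar>A \<tau> \<sigma>\<bar>) / N"
      by (simp add: sum_divide_distrib)
    also have "\<dots> < 1"
    proof -
      have "(\<Sum>\<sigma>\<in>D. \<bar>A \<tau> \<sigma>\<bar>) \<le> (\<Sum>\<tau>\<in>E. \<Sum>\<sigma>\<in>D. \<bar>A \<tau> \<sigma>\<bar>)"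
        using \<tau> fin by (intro member_le_sum) (auto intro: sum_nonneg)
      then have "(\<Sum>\<sigma>\<in>D. \<bar>A \<tau> \<sigma>\<bar>) < int N" using s0 by (simp add: N_def)
      then have "real_of_int (\<Sum>\<sigma>\<in>D. \<bar>A \<tau> \<sigma>\<bar>) < real N" by linarith
      then show ?thesis using \<open>N > 0\<close> by simp
    qed
    finally show "?S = 0" by linarith
  qed
  then have "P \<sigma> = 0" using \<sigma> by simp
  with P[OF \<sigma>] have "\<bar>real_of_int q\<bar> < 1 / N" using nz by (simp add: e_def)
  moreover have "1 / N \<le> 1" using \<open>N > 0\<close> by simp
  ultimately show False using q by linarith
qed

lemma half_int_in_Ints_iff: "(of_int n / 2 :: real) \<in> \<int> \<longleftrightarrow> even n"
proof
  assume "(of_int n / 2 :: real) \<in> \<int>"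
  then obtain k where "(of_int n / 2 :: real) = of_int k" by (elim Ints_cases)
  then have "n = 2 * k" by linarith
  then show "even n" by simp
qed (auto elim!: evenE)

section \<open>Separating an integer vector from a lattice\<close>

lemma int_subgroup_cyclic:
  fixes S :: "int set"
  assumes "S \<noteq> {}" "\<And>x y. x \<in> S \<Longrightarrow> y \<in> S \<Longrightarrow> x - y \<in> S"
  obtains k where "k \<in> S" "\<And>x. x \<in> S \<Longrightarrow> k dvd x"
proof -
  have z: "0 \<in> S" using assms by (metis all_not_in_conv diff_self)
  have neg: "- x \<in> S" if "x \<in> S" for x using assms(2)[OF z that] by simp
  have add: "x + y \<in> S" if "x \<in> S" "y \<in> S" for x y using assms(2)[OF that(1) neg[OF that(2)]] by simp
  have mult: "of_nat n * x \<in> S" if "x \<in> S" for x n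
    by (induction n) (auto simp: z algebra_simps intro: add that)
  have imult: "c * x \<in> S" if "x \<in> S" for x c
    using mult[OF that, of "nat c"] neg[OF mult[OF that, of "nat (- c)"]] by (cases "c \<ge> 0") auto
  have gcd: "gcd x y \<in> S" if "x \<in> S" "y \<in> S" for x y
    using add[OF imult[OF that(1)] imult[OF that(2)]] bezout_int[of x y] by metis
  show thesis
  proof (cases "S = {0}")
    case True
    then show ?thesis using that by auto
  next
    case False
    then obtain x where "x \<in> S" "x \<noteq> 0" using z by auto
    then have ex: "\<exists>n::nat. n > 0 \<and> int n \<in> S"
      using neg by (intro exI[of _ "nat \<bar>x\<bar>"]) (auto simp: abs_if)
    define m where "m = (LEAST n::nat. n > 0 \<and> int n \<in> S)"
    have m: "m > 0" "int m \<in> S" using LeastI_ex[OF ex] by (auto simp: m_def)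
    have "int m dvd x" if "x \<in> S" for x
    proof -
      have "gcd (int m) x \<in> S" using gcd m that by auto
      moreover have "gcd (int m) x > 0" using m by simp
      ultimately have "m \<le> nat (gcd (int m) x)"
        unfolding m_def by (intro Least_le) auto
      moreover have "gcd (int m) x \<le> int m" using m by (simp add: zdvd_imp_le)
      ultimately have "gcd (int m) x = int m" using \<open>gcd (int m) x > 0\<close> by linarith
      then show ?thesis by (metis gcd_dvd2)
    qed
    then show ?thesis using m that by blast
  qed
qed

text \<open>Induction on the coordinates. The \<open>j\<close>-th entries of \<open>L\<close> are
  the multiples of some \<open>k\<close>. If \<open>k\<close> does not divide \<open>x j\<close>, a
  vector supported at \<open>j\<close> separates. Otherwise a multiple of an element of
  \<open>L\<close> with entry \<open>k\<close> moves \<open>x\<close> into the hyperplane where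
  entry \<open>j\<close> vanishes, and the separating vector found there is extended. Rationality of
  \<open>v\<close> is recorded because it later provides the finite order of a homology
  class.\<close>

lemma lattice_separation:
  fixes L :: "('b \<Rightarrow> int) set" and x :: "'b \<Rightarrow> int"
  assumes "finite I" "L \<noteq> {}" "\<And>f g. f \<in> L \<Longrightarrow> g \<in> L \<Longrightarrow> (\<lambda>i. f i - g i) \<in> L"
    and "\<not> (\<exists>f\<in>L. \<forall>i\<in>I. f i = x i)"
  shows "\<exists>v :: 'b \<Rightarrow> real. (\<forall>i\<in>I. v i \<in> \<rat>) \<and> (\<forall>f\<in>L. (\<Sum>i\<in>I. v i * of_int (f i)) \<in> \<int>)
    \<and> (\<Sum>i\<in>I. v i * of_int (x i)) \<notin> \<int>"
  using assms
proof (induction I arbitrary: L x rule: finite_induct)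
  case empty
  then show ?case by auto
next
  case (insert j I)
  note diff = insert.prems(2)
  have zero: "(\<lambda>i. 0) \<in> L" using insert.prems(1) diff by fastforce
  have neg: "(\<lambda>i. - f i) \<in> L" if "f \<in> L" for f using diff[OF zero that] by simp
  have add: "(\<lambda>i. f i + g i) \<in> L" if "f \<in> L" "g \<in> L" for f g using diff[OF that(1) neg[OF that(2)]] by simp
  have nmult: "(\<lambda>i. of_nat n * f i) \<in> L" if "f \<in> L" for f n
  proof (induction n)
    case 0 then show ?case using zero by simp
  next
    case (Suc n) then show ?case using add[OF that Suc] by (simp add: algebra_simps)
  qed
  have mult: "(\<lambda>i. c * f i) \<in> L" if "f \<in> L" for f c
    using nmult[OF that, of "nat c"] neg[OF nmult[OF that, of "nat (- c)"]] by (cases "c \<ge> 0") auto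
  obtain k where "k \<in> (\<lambda>f. f j) ` L" and k: "\<And>y. y \<in> (\<lambda>f. f j) ` L \<Longrightarrow> k dvd y"
  proof (rule int_subgroup_cyclic[of "(\<lambda>f. f j) ` L"])
    show "(\<lambda>f. f j) ` L \<noteq> {}" using insert.prems(1) by simp
    show "x - y \<in> (\<lambda>f. f j) ` L" if "x \<in> (\<lambda>f. f j) ` L" "y \<in> (\<lambda>f. f j) ` L" for x y
      using that by (auto intro: rev_image_eqI[OF diff])
  qed blast
  then obtain l' where l': "l' \<in> L" "l' j = k" by auto
  \<comment> \<open>For \<open>k = 0\<close> every element of \<open>L\<close> has entry 0 at
    \<open>j\<close>, and choosing the zero vector makes the extended \<open>v\<close> pair to 0
    with \<open>l\<close> trivially.\<close>
  define l where "l = (if k = 0 then (\<lambda>_. 0) else l')"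
  have l: "l \<in> L" "l j = k" "k = 0 \<Longrightarrow> l = (\<lambda>_. 0)" using l' zero by (auto simp: l_def)
  have kd: "k dvd f j" if "f \<in> L" for f using k that by auto
  have sums: "(\<Sum>i\<in>I. (if i = j then a i else b i) * c i) = (\<Sum>i\<in>I. b i * c i :: real)" for a b c
    using insert.hyps by (intro sum.cong) auto
  show ?case
  proof (cases "k dvd x j")
    case False
    \<comment> \<open>If \<open>k = 0\<close>, all of \<open>L\<close> vanishes at \<open>j\<close>,
      and the value is chosen to give \<open>x\<close> the pairing \<open>1/2\<close>; otherwise
      \<open>1 / k\<close> pairs integrally with the multiples of \<open>k\<close> and with nothing
      else.\<close>
    define v where "v i = (if i = j then (if k = 0 then 1 / (2 * of_int (x j)) else 1 / of_int k) else 0 :: real)" for i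
    have s: "(\<Sum>i\<in>insert j I. v i * of_int (f i)) = v j * of_int (f j)" for f
      using insert.hyps by (simp add: v_def sums)
    have "v j * of_int (f j) \<in> \<int>" if "f \<in> L" for f
      using kd[OF that] by (auto simp: v_def elim!: dvdE)
    moreover have "v j * of_int (x j) \<notin> \<int>"
    proof (cases "k = 0")
      case True
      then have "v j * of_int (x j) = of_int 1 / 2" using False by (simp add: v_def)
      then show ?thesis by (simp only: half_int_in_Ints_iff) simp
    next
      case nz: False
      show ?thesis
      proof
        assume "v j * of_int (x j) \<in> \<int>"
        then obtain q where "real_of_int (x j) / of_int k = of_int q"
          using nz by (auto simp: v_def elim!: Ints_cases)
        then have "x j = k * q" using nz by (simp add: field_simps flip: of_int_mult)
        then show False using False by simp
      qed
    qed
    moreover have "\<forall>i\<in>insert j I. v i \<in> \<rat>" by (auto simp: v_def)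
    ultimately show ?thesis by (intro exI[of _ v]) (auto simp: s)
  next
    case True
    then obtain q where q: "x j = q * k" by (metis dvdE mult.commute)
    define L' where "L' = {f \<in> L. f j = 0}"
    define x' where "x' i = x i - q * l i" for i
    have "\<exists>v :: 'b \<Rightarrow> real. (\<forall>i\<in>I. v i \<in> \<rat>) \<and> (\<forall>f\<in>L'. (\<Sum>i\<in>I. v i * of_int (f i)) \<in> \<int>)
        \<and> (\<Sum>i\<in>I. v i * of_int (x' i)) \<notin> \<int>"
    proof (rule insert.IH)
      show "L' \<noteq> {}" using zero by (auto simp: L'_def)
      show "(\<lambda>i. f i - g i) \<in> L'" if "f \<in> L'" "g \<in> L'" for f g
        using that diff by (auto simp: L'_def)
      show "\<not> (\<exists>f\<in>L'. \<forall>i\<in>I. f i = x' i)"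
      proof
        assume "\<exists>f\<in>L'. \<forall>i\<in>I. f i = x' i"
        then obtain f where f: "f \<in> L" "f j = 0" "\<forall>i\<in>I. f i = x' i" by (auto simp: L'_def)
        have "\<forall>i\<in>insert j I. f i + q * l i = x i" using f q l by (auto simp: x'_def)
        then show False using add[OF f(1) mult[OF l(1), of q]] insert.prems(3) by auto
      qed
    qed
    then obtain v :: "'b \<Rightarrow> real" where v: "\<forall>i\<in>I. v i \<in> \<rat>" "\<And>f. f \<in> L' \<Longrightarrow> (\<Sum>i\<in>I. v i * of_int (f i)) \<in> \<int>"
      "(\<Sum>i\<in>I. v i * of_int (x' i)) \<notin> \<int>" by auto
    \<comment> \<open>\<open>t\<close> makes \<open>w\<close> pair to 0 with \<open>l\<close>, so
      that adding multiples of \<open>l\<close> does not change a pairing. For \<open>k = 0\<close>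
      division yields \<open>t = 0\<close>, which is right since then \<open>l\<close> is
      zero.\<close>
    define t where "t = - (\<Sum>i\<in>I. v i * of_int (l i)) / of_int k"
    define w where "w i = (if i = j then t else v i)" for i
    have w: "(\<Sum>i\<in>insert j I. w i * of_int (f i + c * l i)) = (\<Sum>i\<in>I. v i * of_int (f i))"
      if "f j = 0" for f c
    proof -
      have "t * of_int (l j) + (\<Sum>i\<in>I. v i * of_int (l i)) = 0"
        using l by (cases "k = 0") (auto simp: t_def)
      then have l0: "of_int c * (t * of_int (l j) + (\<Sum>i\<in>I. v i * of_int (l i))) = 0"
        by simp
      have "(\<Sum>i\<in>insert j I. w i * of_int (f i + c * l i)) =
         t * (of_int c * of_int (l j)) + (\<Sum>i\<in>I. v i * of_int (f i)) + of_int c * (\<Sum>i\<in>I. v i * of_int (l i))"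
        using insert.hyps that by (simp add: w_def sums) (simp add: algebra_simps sum.distrib sum_distrib_left)
      then show ?thesis using l0 by (simp add: algebra_simps)
    qed
    show ?thesis
    proof (intro exI[of _ w] conjI ballI)
      have "t \<in> \<rat>" unfolding t_def using v(1) by (intro Rats_divide Rats_minus_iff[THEN iffD2] Rats_sum Rats_mult) auto
      then show "w i \<in> \<rat>" if "i \<in> insert j I" for i using that v(1) by (auto simp: w_def)
    next
      fix f assume f: "f \<in> L"
      then obtain c where c: "f j = k * c" using kd by (auto elim!: dvdE)
      define f' where "f' = (\<lambda>i. f i - c * l i)"
      have "f' \<in> L'" using diff[OF f mult[OF l(1), of c]] c l by (auto simp: L'_def f'_def)
      then have "(\<Sum>i\<in>I. v i * of_int (f' i)) \<in> \<int>" by (rule v(2))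
      moreover have "(\<Sum>i\<in>insert j I. w i * of_int (f' i + c * l i)) = (\<Sum>i\<in>I. v i * of_int (f' i))"
        using c l by (intro w) (auto simp: f'_def)
      ultimately show "(\<Sum>i\<in>insert j I. w i * of_int (f i)) \<in> \<int>" by (simp add: f'_def)
    next
      have "(\<Sum>i\<in>insert j I. w i * of_int (x' i + q * l i)) = (\<Sum>i\<in>I. v i * of_int (x' i))"
        using q l by (intro w) (auto simp: x'_def)
      then show "(\<Sum>i\<in>insert j I. w i * of_int (x i)) \<notin> \<int>" using v(3) by (simp add: x'_def)
    qed
  qed
qed

section \<open>Abelian groups whose torsion has exponent 2\<close>

definition int_lincomb :: "('i \<Rightarrow> int) \<Rightarrow> ('i \<Rightarrow> 'a::real_vector) \<Rightarrow> 'i set \<Rightarrow> 'a" where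
  "int_lincomb m f I = (\<Sum>i\<in>I. of_int (m i) *\<^sub>R f i)"

definition zsubmodule :: "'a::real_vector set \<Rightarrow> bool" where
  "zsubmodule S \<longleftrightarrow> S \<noteq> {} \<and> (\<forall>x\<in>S. \<forall>y\<in>S. x - y \<in> S)"

lemma zsubmodule_diff: "zsubmodule S \<Longrightarrow> x \<in> S \<Longrightarrow> y \<in> S \<Longrightarrow> x - y \<in> S"
  by (simp add: zsubmodule_def)

lemma zsubmodule_zero: "zsubmodule S \<Longrightarrow> 0 \<in> S"
  unfolding zsubmodule_def by (metis all_not_in_conv diff_self)

lemma zsubmodule_minus: "zsubmodule S \<Longrightarrow> x \<in> S \<Longrightarrow> - x \<in> S"
  using zsubmodule_diff[of S 0 x] zsubmodule_zero by auto

lemma zsubmodule_add: "zsubmodule S \<Longrightarrow> x \<in> S \<Longrightarrow> y \<in> S \<Longrightarrow> x + y \<in> S"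
  using zsubmodule_diff[of S x "- y"] zsubmodule_minus by auto

lemma zsubmodule_scaleR_int:
  assumes "zsubmodule S" "x \<in> S"
  shows "of_int k *\<^sub>R x \<in> S"
proof -
  have nat: "real n *\<^sub>R x \<in> S" for n
    by (induction n) (auto simp: algebra_simps assms zsubmodule_zero intro: zsubmodule_add)
  show ?thesis
  proof (cases "k \<ge> 0")
    case True
    then show ?thesis using nat[of "nat k"] by simp
  next
    case False
    then show ?thesis using zsubmodule_minus[OF assms(1) nat[of "nat (- k)"]] by simp
  qed
qed

lemma zsubmodule_sum:
  assumes "zsubmodule S" "\<And>i. i \<in> I \<Longrightarrow> f i \<in> S"
  shows "(\<Sum>i\<in>I. f i) \<in> S"
  using assms(2)
  by (induction I rule: infinite_finite_induct)
    (auto intro: zsubmodule_add zsubmodule_zero assms(1))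

lemma zsubmodule_int_lincomb:
  assumes "zsubmodule S" "\<And>i. i \<in> I \<Longrightarrow> f i \<in> S"
  shows "int_lincomb m f I \<in> S"
  unfolding int_lincomb_def
  using assms by (intro zsubmodule_sum zsubmodule_scaleR_int)

lemma int_lincomb_diff: "int_lincomb m f I - int_lincomb m' f I = int_lincomb (\<lambda>i. m i - m' i) f I"
  by (simp add: int_lincomb_def scaleR_left_diff_distrib sum_subtractf)

lemma int_lincomb_insert:
  "finite I \<Longrightarrow> i \<notin> I \<Longrightarrow> int_lincomb m f (insert i I) = of_int (m i) *\<^sub>R f i + int_lincomb m f I"
  by (simp add: int_lincomb_def)

lemma int_lincomb_remove:
  "finite I \<Longrightarrow> i \<in> I \<Longrightarrow> int_lincomb m f I = of_int (m i) *\<^sub>R f i + int_lincomb m f (I - {i})"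
  by (simp add: int_lincomb_def sum.remove)

lemma int_lincomb_cong:
  "(\<And>i. i \<in> I \<Longrightarrow> m i = m' i) \<Longrightarrow> (\<And>i. i \<in> I \<Longrightarrow> f i = f' i) \<Longrightarrow> int_lincomb m f I = int_lincomb m' f' I"
  by (simp add: int_lincomb_def)

text \<open>The quotient \<open>Z/B\<close> is never formed: congruence modulo \<open>B\<close> is
  membership of a difference. Generators are an indexed family and not a set, so that a change of
  generators keeps the index set even if two of them coincide.\<close>

definition generates_mod :: "('i \<Rightarrow> 'a::real_vector) \<Rightarrow> 'i set \<Rightarrow> 'a set \<Rightarrow> 'a set \<Rightarrow> bool" where
  "generates_mod f I B Z \<longleftrightarrow> (\<forall>i\<in>I. f i \<in> Z) \<and> (\<forall>z\<in>Z. \<exists>m. z - int_lincomb m f I \<in> B)"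

lemma generates_mod_mono: "generates_mod f I B Z \<Longrightarrow> B \<subseteq> B' \<Longrightarrow> generates_mod f I B' Z"
  unfolding generates_mod_def by blast

text \<open>A Euclidean step on the coefficients: the multiple of \<open>f i\<close> added to
  generator \<open>j\<close> is compensated in the coefficient of \<open>f i\<close>.\<close>

lemma shear_int_lincomb:
  fixes f :: "'i \<Rightarrow> 'a::real_vector"
  assumes "finite I" "i \<in> I" "j \<in> I" "i \<noteq> j"
  shows "int_lincomb (m(i := m i - s * m j)) (f(j := f j + of_int s *\<^sub>R f i)) I = int_lincomb m f I"
proof -
  have *: "int_lincomb m f I = of_int (m i) *\<^sub>R f i + (of_int (m j) *\<^sub>R f j + int_lincomb m f (I - {i} - {j}))" for m and f :: "'i \<Rightarrow> 'a"
    using assms int_lincomb_remove[of I i m f] int_lincomb_remove[of "I - {i}" j m f] by auto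
  have "int_lincomb (m(i := m i - s * m j)) (f(j := f j + of_int s *\<^sub>R f i)) (I - {i} - {j}) = int_lincomb m f (I - {i} - {j})"
    by (rule int_lincomb_cong) auto
  then show ?thesis
    unfolding *[of "m(i := m i - s * m j)" "f(j := f j + of_int s *\<^sub>R f i)"] *[of m f]
    using assms by (simp add: algebra_simps)
qed

lemma shear_generates_mod:
  fixes f :: "'i \<Rightarrow> 'a::real_vector"
  assumes "finite I" "i \<in> I" "j \<in> I" "i \<noteq> j" "zsubmodule Z" "generates_mod f I B Z"
  shows "generates_mod (f(j := f j + of_int s *\<^sub>R f i)) I B Z"
  unfolding generates_mod_def
proof (intro conjI ballI)
  fix k assume "k \<in> I"
  then show "(f(j := f j + of_int s *\<^sub>R f i)) k \<in> Z"
    using assms by (auto simp: generates_mod_def intro: zsubmodule_add zsubmodule_scaleR_int)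
next
  fix z assume "z \<in> Z"
  then obtain m where "z - int_lincomb m f I \<in> B" using assms(6) by (auto simp: generates_mod_def)
  then show "\<exists>m. z - int_lincomb m (f(j := f j + of_int s *\<^sub>R f i)) I \<in> B"
    using shear_int_lincomb[OF assms(1-4)] by metis
qed

text \<open>A shortest nontrivial relation, over all generating families with the given index set,
  involves a single generator: otherwise a shear shortens it.\<close>

lemma relation_on_single_generator:
  fixes f :: "'i \<Rightarrow> 'a::real_vector"
  assumes I: "finite I" and Z: "zsubmodule Z"
    and "generates_mod f I B Z" "int_lincomb m f I \<in> B" "\<exists>i\<in>I. m i \<noteq> 0"
  obtains g i k where "generates_mod g I B Z" "i \<in> I" "k \<noteq> 0" "of_int k *\<^sub>R g i \<in> B"
proof -
  have "\<exists>g i k. generates_mod g I B Z \<and> i \<in> I \<and> k \<noteq> 0 \<and> of_int k *\<^sub>R g i \<in> B"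
    using assms(3-)
  proof (induction "\<Sum>i\<in>I. nat \<bar>m i\<bar>" arbitrary: m f rule: less_induct)
    case less
    obtain i where i: "i \<in> I" "m i \<noteq> 0" using less.prems by auto
    show ?case
    proof (cases "\<exists>j\<in>I. j \<noteq> i \<and> m j \<noteq> 0")
      case False
      have "int_lincomb m f (I - {i}) = 0" unfolding int_lincomb_def using False by (intro sum.neutral) auto
      then have "int_lincomb m f I = of_int (m i) *\<^sub>R f i"
        using int_lincomb_remove[OF I i(1), of m f] by simp
      then show ?thesis using less.prems i by metis
    next
      case True
      then obtain j where j: "j \<in> I" "j \<noteq> i" "m j \<noteq> 0" by auto
      have red: ?thesis if ab: "a \<in> I" "b \<in> I" "a \<noteq> b" "m a \<noteq> 0" "m b \<noteq> 0" "\<bar>m b\<bar> \<le> \<bar>m a\<bar>" for a b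
      proof (rule less.hyps)
        \<comment> \<open>With this sign the new coefficient at \<open>a\<close> has absolute value
          \<open>\<bar>m a\<bar> - \<bar>m b\<bar>\<close>, while \<open>m b\<close> is unchanged
          and keeps the relation nontrivial.\<close>
        let ?s = "sgn (m a) * sgn (m b)"
        let ?m = "m(a := m a - ?s * m b)" and ?f = "f(b := f b + of_int ?s *\<^sub>R f a)"
        have "\<bar>?m a\<bar> < \<bar>m a\<bar>" using ab by (auto simp: sgn_if split: if_splits)
        then show "(\<Sum>i\<in>I. nat \<bar>?m i\<bar>) < (\<Sum>i\<in>I. nat \<bar>m i\<bar>)"
          using I ab(1) by (intro sum_strict_mono_ex1) (auto intro!: bexI[of _ a])
        show "generates_mod ?f I B Z" by (rule shear_generates_mod) (use I Z less.prems ab in auto)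
        show "int_lincomb ?m ?f I \<in> B" unfolding shear_int_lincomb[OF I ab(1-3)] by (rule less.prems)
        show "\<exists>i\<in>I. ?m i \<noteq> 0" using ab by (intro bexI[of _ b]) auto
      qed
      show ?thesis using red[OF i(1) j(1)] red[OF j(1) i(1)] i j by (metis linear)
    qed
  qed
  then show thesis using that by blast
qed

text \<open>In the conclusion \<open>U\<close> indexes a basis of a free part of \<open>Z/B\<close> and \<open>V\<close> an \<open>F\<^sub>2\<close>-basis of the
  torsion. If the generators satisfy a relation, one of them can be taken to have order 2 in
  \<open>Z/B\<close>; it then splits off as a direct summand or is redundant.\<close>

lemma free_plus_Z2_generators:
  fixes f :: "'i \<Rightarrow> 'a::real_vector"
  assumes "finite I" "zsubmodule B" "zsubmodule Z" "B \<subseteq> Z" "generates_mod f I B Z"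
    and "\<And>z k. z \<in> Z \<Longrightarrow> k \<noteq> 0 \<Longrightarrow> of_int k *\<^sub>R z \<in> B \<Longrightarrow> 2 *\<^sub>R z \<in> B"
  shows "\<exists>g U V. U \<inter> V = {} \<and> U \<union> V \<subseteq> I \<and> generates_mod g (U \<union> V) B Z \<and> (\<forall>y\<in>V. 2 *\<^sub>R g y \<in> B)
    \<and> (\<forall>m. int_lincomb m g (U \<union> V) \<in> B \<longrightarrow> (\<forall>x\<in>U. m x = 0) \<and> (\<forall>y\<in>V. even (m y)))"
  using assms
proof (induction "card I" arbitrary: I f Z)
  case 0
  then have "I = {}" by simp
  then show ?case using 0 by (intro exI[of _ f] exI[of _ "{}"]) auto
next
  case (Suc n)
  note B = Suc.prems(2) and Z = Suc.prems(3) and tors = Suc.prems(6)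
  show ?case
  proof (cases "\<exists>m. int_lincomb m f I \<in> B \<and> (\<exists>i\<in>I. m i \<noteq> 0)")
    case False
    \<comment> \<open>Without relations all generators are free, so \<open>V\<close> is
      empty.\<close>
    then show ?thesis using Suc.prems
      by (intro exI[of _ f] exI[of _ I] exI[of _ "{}"]) auto
  next
    case True
    then obtain g i k where g: "generates_mod g I B Z" and i: "i \<in> I" and k: "k \<noteq> 0" "of_int k *\<^sub>R g i \<in> B"
      using relation_on_single_generator[OF Suc.prems(1) Z Suc.prems(5)] by metis
    have gZ: "g j \<in> Z" if "j \<in> I" for j using g that by (auto simp: generates_mod_def)
    have two: "2 *\<^sub>R g i \<in> B" using tors gZ[OF i] k by blast
    have even: "of_int c *\<^sub>R g i \<in> B" if ev: "even c" for c
    proof -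
      obtain e where "c = 2 * e" using ev by (elim evenE)
      then show ?thesis using zsubmodule_scaleR_int[OF B two, of e] by (simp add: mult.commute)
    qed
    \<comment> \<open>\<open>W\<close> is generated by \<open>B\<close> and the remaining
      generators; the induction hypothesis is applied to it in place of \<open>Z\<close>.\<close>
    define W where "W = {z. \<exists>m. z - int_lincomb m g (I - {i}) \<in> B}"
    have rem: "int_lincomb m g I = of_int (m i) *\<^sub>R g i + int_lincomb m g (I - {i})" for m
      by (rule int_lincomb_remove) (use Suc.prems i in auto)
    have W: "zsubmodule W"
      unfolding zsubmodule_def
    proof (intro conjI ballI)
      have "0 \<in> W" unfolding W_def using zsubmodule_zero[OF B]
        by (auto intro!: exI[of _ "\<lambda>_. 0"] simp: int_lincomb_def)
      then show "W \<noteq> {}" by auto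
      fix x y assume "x \<in> W" "y \<in> W"
      then obtain m m' where "x - int_lincomb m g (I - {i}) \<in> B" "y - int_lincomb m' g (I - {i}) \<in> B"
        by (auto simp: W_def)
      from zsubmodule_diff[OF B this]
      have "(x - y) - (int_lincomb m g (I - {i}) - int_lincomb m' g (I - {i})) \<in> B"
        by (simp add: algebra_simps)
      then show "x - y \<in> W" unfolding W_def int_lincomb_diff by auto
    qed
    have BW: "B \<subseteq> W" unfolding W_def by (auto intro!: exI[of _ "\<lambda>_. 0"] simp: int_lincomb_def)
    have WZ: "W \<subseteq> Z"
    proof
      fix z assume "z \<in> W"
      then obtain m where "z - int_lincomb m g (I - {i}) \<in> B" by (auto simp: W_def)
      moreover have "int_lincomb m g (I - {i}) \<in> Z" by (rule zsubmodule_int_lincomb[OF Z]) (auto intro: gZ)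
      ultimately show "z \<in> Z" using zsubmodule_add[OF Z] Suc.prems(4) by (metis diff_add_cancel subsetD)
    qed
    have gW: "g j \<in> W" if "j \<in> I - {i}" for j
    proof -
      have "int_lincomb (\<lambda>k. if k = j then 1 else 0) g (I - {i}) = g j"
        unfolding int_lincomb_def using Suc.prems(1) that by (simp add: if_distrib[of "\<lambda>c. of_int c *\<^sub>R _"] cong: if_cong)
      then show ?thesis unfolding W_def using zsubmodule_zero[OF B]
        by (auto intro!: exI[of _ "\<lambda>k. if k = j then 1 else 0"])
    qed
    have "\<exists>g' U V. U \<inter> V = {} \<and> U \<union> V \<subseteq> I - {i} \<and> generates_mod g' (U \<union> V) B W \<and> (\<forall>y\<in>V. 2 *\<^sub>R g' y \<in> B)
      \<and> (\<forall>m. int_lincomb m g' (U \<union> V) \<in> B \<longrightarrow> (\<forall>x\<in>U. m x = 0) \<and> (\<forall>y\<in>V. even (m y)))"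
    proof (rule Suc.hyps(1))
      show "n = card (I - {i})" using Suc.hyps(2) Suc.prems(1) i by simp
      show "generates_mod g (I - {i}) B W" using gW by (auto simp: generates_mod_def W_def)
      show "2 *\<^sub>R z \<in> B" if "z \<in> W" "k \<noteq> 0" "of_int k *\<^sub>R z \<in> B" for z k
        using tors that WZ by blast
      show "finite (I - {i})" using Suc.prems(1) by simp
    qed (rule B W BW)+
    then obtain g' U V where g': "U \<inter> V = {}" "U \<union> V \<subseteq> I - {i}" "generates_mod g' (U \<union> V) B W"
      "\<forall>y\<in>V. 2 *\<^sub>R g' y \<in> B"
      "\<And>m. int_lincomb m g' (U \<union> V) \<in> B \<Longrightarrow> (\<forall>x\<in>U. m x = 0) \<and> (\<forall>y\<in>V. even (m y))"
      by (elim exE conjE) simp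
    have finUV: "finite (U \<union> V)" using g'(2) Suc.prems(1) finite_subset by blast
    have g'W: "g' j \<in> W" if "j \<in> U \<union> V" for j using g'(3) that by (auto simp: generates_mod_def)
    have split: "\<exists>c w. w \<in> W \<and> z = of_int c *\<^sub>R g i + w" if zZ: "z \<in> Z" for z
    proof -
      obtain m where "z - int_lincomb m g I \<in> B" using g zZ by (auto simp: generates_mod_def)
      then have "z - of_int (m i) *\<^sub>R g i \<in> W" unfolding W_def rem by (auto simp: algebra_simps)
      then show ?thesis by (metis add.commute diff_add_cancel)
    qed
    show ?thesis
    proof (cases "g i \<in> W")
      case True
      have "Z \<subseteq> W"
        using split zsubmodule_add[OF W zsubmodule_scaleR_int[OF W True]] by blast
      then have "W = Z" using WZ by auto
      then show ?thesis using g'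
        by (rule_tac x = g' in exI, rule_tac x = U in exI, rule_tac x = V in exI) auto
    next
      case False
      have nUV: "i \<notin> U \<union> V" using g'(2) by auto
      define h where "h = g'(i := g i)"
      have ins: "int_lincomb m h (U \<union> insert i V) = of_int (m i) *\<^sub>R g i + int_lincomb m g' (U \<union> V)" for m
      proof -
        have "int_lincomb m h (U \<union> V) = int_lincomb m g' (U \<union> V)"
          by (rule int_lincomb_cong) (use nUV in \<open>auto simp: h_def\<close>)
        then show ?thesis using int_lincomb_insert[OF finUV nUV, of m h] by (simp add: h_def)
      qed
      show ?thesis
      proof (rule exI[of _ h], rule exI[of _ U], rule exI[of _ "insert i V"], intro conjI allI impI)
        show "U \<inter> insert i V = {}" using g'(1) nUV by auto
        show "U \<union> insert i V \<subseteq> I" using g'(2) i by auto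
        show "\<forall>y\<in>insert i V. 2 *\<^sub>R h y \<in> B" using g'(4) two nUV by (auto simp: h_def)
        show "generates_mod h (U \<union> insert i V) B Z"
          unfolding generates_mod_def
        proof (intro conjI ballI)
          fix j assume "j \<in> U \<union> insert i V"
          then show "h j \<in> Z" using gZ[OF i] g'W WZ by (auto simp: h_def)
        next
          fix z assume "z \<in> Z"
          then obtain c w where w: "w \<in> W" "z = of_int c *\<^sub>R g i + w" using split by blast
          then obtain m where m: "w - int_lincomb m g' (U \<union> V) \<in> B" using g'(3) by (auto simp: generates_mod_def)
          have "int_lincomb (m(i := c)) g' (U \<union> V) = int_lincomb m g' (U \<union> V)"
            by (rule int_lincomb_cong) (use nUV in auto)
          then show "\<exists>m. z - int_lincomb m h (U \<union> insert i V) \<in> B"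
            using m w by (intro exI[of _ "m(i := c)"], subst ins) simp
        qed
      next
        fix m assume m: "int_lincomb m h (U \<union> insert i V) \<in> B"
        \<comment> \<open>An odd coefficient would put \<open>g i\<close> itself into
          \<open>W\<close>, because even multiples of \<open>g i\<close> already lie in
          \<open>B\<close>.\<close>
        have ev: "even (m i)"
        proof (rule ccontr)
          assume "odd (m i)"
          then have e: "of_int (m i - 1) *\<^sub>R g i \<in> B" by (intro even) auto
          have "int_lincomb m g' (U \<union> V) \<in> W" by (rule zsubmodule_int_lincomb[OF W g'W])
          then have "of_int (m i) *\<^sub>R g i \<in> W"
            using m zsubmodule_diff[OF W] BW unfolding ins by (metis add_diff_cancel_right' subsetD)
          from zsubmodule_diff[OF W this subsetD[OF BW e]]
          have "g i \<in> W" by (simp add: scaleR_left_diff_distrib)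
          then show False using False by simp
        qed
        then have "int_lincomb m g' (U \<union> V) \<in> B"
          using zsubmodule_diff[OF B m[unfolded ins] even[OF ev]] by simp
        from g'(5)[OF this] ev show "\<forall>x\<in>U. m x = 0" "\<forall>y\<in>insert i V. even (m y)" by auto
      qed
    qed
  qed
qed

section \<open>Reflexive cross-polytopes\<close>

text \<open>Echelon reduction: the \<open>j\<close>-th entries are the multiples of some
  \<open>k\<close>, an element attaining \<open>k\<close> clears that entry, and what is left has
  one coordinate fewer. The generators come indexed by the coordinates, so no rank has to be
  computed.\<close>

lemma integral_zsubmodule_generated:
  fixes Z :: "(real ^ 'm::finite) set"
  assumes "finite I" "zsubmodule Z" "\<And>z. z \<in> Z \<Longrightarrow> integral_vector z"
    and "\<And>z i. z \<in> Z \<Longrightarrow> i \<notin> I \<Longrightarrow> z $ i = 0"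
  shows "\<exists>f. generates_mod f I {0} Z"
  using assms
proof (induction I arbitrary: Z rule: finite_induct)
  case empty
  then have "z = 0" if "z \<in> Z" for z using that by (auto simp: vec_eq_iff)
  then show ?case by (auto simp: generates_mod_def int_lincomb_def)
next
  case (insert j I)
  note Z = insert.prems(1)
  define S where "S = {k :: int. \<exists>z\<in>Z. z $ j = of_int k}"
  obtain k where "k \<in> S" and k: "\<And>y. y \<in> S \<Longrightarrow> k dvd y"
  proof (rule int_subgroup_cyclic[of S])
    have "0 \<in> S" unfolding S_def using zsubmodule_zero[OF Z] by (auto intro!: bexI[of _ 0])
    then show "S \<noteq> {}" by auto
    show "x - y \<in> S" if "x \<in> S" "y \<in> S" for x y
      using that unfolding S_def by (auto intro!: bexI[OF _ zsubmodule_diff[OF Z]])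
  qed blast
  then obtain l where l: "l \<in> Z" "l $ j = of_int k" by (auto simp: S_def)
  define Z' where "Z' = {z \<in> Z. z $ j = 0}"
  have "\<exists>f. generates_mod f I {0} Z'"
  proof (rule insert.IH)
    show "zsubmodule Z'" unfolding zsubmodule_def Z'_def
      using zsubmodule_zero[OF Z] zsubmodule_diff[OF Z] by auto
    show "integral_vector z" if "z \<in> Z'" for z using that insert.prems by (auto simp: Z'_def)
    show "z $ i = 0" if "z \<in> Z'" "i \<notin> I" for z i
      using that insert.prems(3)[of z i] by (cases "i = j") (auto simp: Z'_def)
  qed
  then obtain f where f: "generates_mod f I {0} Z'" by blast
  have "generates_mod (f(j := l)) (insert j I) {0} Z"
    unfolding generates_mod_def
  proof (intro conjI ballI)
    fix i assume "i \<in> insert j I"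
    then show "(f(j := l)) i \<in> Z" using l f by (auto simp: generates_mod_def Z'_def)
  next
    fix z assume z: "z \<in> Z"
    then obtain y where y: "z $ j = of_int y" using insert.prems(2) by (metis Ints_cases integral_vector_def)
    then obtain c where c: "y = k * c" using k z unfolding S_def by (auto elim!: dvdE)
    have "z - of_int c *\<^sub>R l \<in> Z'"
      using y c l zsubmodule_diff[OF Z z zsubmodule_scaleR_int[OF Z l(1)]] by (simp add: Z'_def)
    then obtain m where m: "z - of_int c *\<^sub>R l - int_lincomb m f I = 0" using f by (auto simp: generates_mod_def)
    have "int_lincomb (m(j := c)) (f(j := l)) (insert j I) = of_int c *\<^sub>R l + int_lincomb m f I"
      using insert.hyps by (simp add: int_lincomb_insert) (rule int_lincomb_cong, auto)
    with m show "\<exists>m. z - int_lincomb m (f(j := l)) (insert j I) \<in> {0}"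
      by (intro exI[of _ "m(j := c)"]) (simp add: algebra_simps)
  qed
  then show ?case by blast
qed

text \<open>A linear functional with the prescribed values exists by independence, and its adjoint
  at 1 is the vector representing it.\<close>

lemma independent_inner_extend:
  fixes S :: "'a::euclidean_space set"
  assumes "independent S"
  shows "\<exists>u. \<forall>x\<in>S. u \<bullet> x = h x"
proof -
  obtain g :: "'a \<Rightarrow> real" where g: "linear g" "\<forall>x\<in>S. g x = h x"
    using linear_independent_extend[OF assms, of h] by blast
  have "adjoint g 1 \<bullet> x = g x" for x
    using adjoint_works[OF g(1), of x 1] by (simp add: inner_commute)
  with g(2) show ?thesis by (intro exI[of _ "adjoint g 1"]) simp
qed

text \<open>The facet belonging to \<open>\<epsilon>\<close> is the hull of the points
  \<open>\<epsilon> \<sigma> *\<^sub>R a \<sigma>\<close>, and a vector supporting it at level 1 is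
  exactly one with \<open>w \<bullet> a \<sigma> = \<epsilon> \<sigma>\<close>. The polytope need
  not span the space, so such a vector need not be unique and only the existence of an integral one
  is asked.\<close>

lemma reflexive_crosspolytope_iff:
  fixes a :: "'b \<Rightarrow> real ^ 'm::finite"
  assumes fin: "finite D" and ne: "D \<noteq> {}" and inj: "inj_on a D" and ind: "independent (a ` D)"
    and int: "\<And>\<sigma>. \<sigma> \<in> D \<Longrightarrow> integral_vector (a \<sigma>)"
  shows "reflexive (convex hull (a ` D \<union> uminus ` a ` D)) \<longleftrightarrow>
    (\<forall>\<epsilon>. (\<forall>\<sigma>\<in>D. \<epsilon> \<sigma> \<in> {1, -1}) \<longrightarrow> (\<exists>w. integral_vector w \<and> (\<forall>\<sigma>\<in>D. w \<bullet> a \<sigma> = \<epsilon> \<sigma>)))"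
    (is "reflexive ?P \<longleftrightarrow> ?R")
proof -
  define V where "V = a ` D \<union> uminus ` a ` D"
  have P: "?P = convex hull V" by (simp add: V_def)
  have finV: "finite V" using fin by (simp add: V_def)
  have aV: "a \<sigma> \<in> ?P" "- a \<sigma> \<in> ?P" if "\<sigma> \<in> D" for \<sigma>
    using that by (auto intro!: hull_inc)
  obtain \<sigma>0 where \<sigma>0: "\<sigma>0 \<in> D" using ne by auto
  have zero: "0 \<in> ?P"
    using convexD[OF convex_convex_hull aV(1)[OF \<sigma>0] aV(2)[OF \<sigma>0], of "1/2" "1/2"] by simp
  have dimV: "dim V = card D"
  proof -
    have "V \<subseteq> span (a ` D)" unfolding V_def by (auto intro: span_base span_neg)
    then have "dim V = dim (a ` D)"
      by (intro antisym dim_mono) (auto simp: V_def intro: span_base)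
    then show ?thesis using dim_eq_card_independent[OF ind] card_image[OF inj] by simp
  qed
  have affP: "aff_dim ?P = int (card D)"
  proof -
    have "0 \<in> affine hull V"
      using zero convex_hull_subset_affine_hull[of V] unfolding P by (rule rev_subsetD)
    then show ?thesis unfolding P aff_dim_convex_hull by (simp add: aff_dim_zero dimV)
  qed
  have lat: "lattice_polytope ?P"
    unfolding lattice_polytope_def P
    by (intro exI[of _ V] conjI finV refl) (use int in \<open>auto simp: V_def integral_vector_def\<close>)
  have "uminus ` V = V" by (force simp: V_def image_Un image_image)
  then have sym: "uminus ` ?P = ?P"
    unfolding P by (metis convex_hull_linear_image linear_uminus)
  have sub: "?P \<subseteq> {x. u \<bullet> x \<le> 1}" if "\<And>\<sigma>. \<sigma> \<in> D \<Longrightarrow> \<bar>u \<bullet> a \<sigma>\<bar> \<le> 1" for u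
    using that by (intro hull_minimal convex_halfspace_le) (force simp: abs_le_iff)
  show ?thesis
  proof
    assume refl: "reflexive ?P"
    show ?R
    proof (intro allI impI)
      fix \<epsilon> :: "'b \<Rightarrow> real" assume \<epsilon>: "\<forall>\<sigma>\<in>D. \<epsilon> \<sigma> \<in> {1, -1}"
      obtain u where "\<forall>x\<in>a ` D. u \<bullet> x = \<epsilon> (inv_into D a x)"
        using independent_inner_extend[OF ind, of "\<lambda>x. \<epsilon> (inv_into D a x)"] by auto
      then have u: "u \<bullet> a \<sigma> = \<epsilon> \<sigma>" if "\<sigma> \<in> D" for \<sigma>
        using that inj by simp
      define F where "F = ?P \<inter> {x. u \<bullet> x = 1}"
      have "\<bar>u \<bullet> a \<sigma>\<bar> \<le> 1" if "\<sigma> \<in> D" for \<sigma>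
        using u[OF that] bspec[OF \<epsilon> that] by auto
      then have uP: "?P \<subseteq> {x. u \<bullet> x \<le> 1}" by (rule sub)
      then have face: "F face_of ?P" unfolding F_def
        by (intro face_of_Int_supporting_hyperplane_le) auto
      have S: "\<epsilon> \<sigma> *\<^sub>R a \<sigma> \<in> F" if "\<sigma> \<in> D" for \<sigma>
        using bspec[OF \<epsilon> that] u[OF that] aV[OF that] by (auto simp: F_def)
      have "F \<noteq> ?P"
      proof
        assume "F = ?P"
        then have "u \<bullet> 0 = 1" using zero F_def by blast
        then show False by simp
      qed
      then have lt: "aff_dim F < int (card D)" using face_of_aff_dim_lt[OF _ face] affP by simp
      \<comment> \<open>\<open>F\<close> spans \<open>card D\<close> independent columns, and adding
        the origin raises the affine dimension by at most one; so \<open>F\<close> has codimension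
        exactly one in the polytope.\<close>
      have "a ` D \<subseteq> span F"
      proof clarify
        fix \<sigma> assume "\<sigma> \<in> D"
        then have "\<epsilon> \<sigma> *\<^sub>R (\<epsilon> \<sigma> *\<^sub>R a \<sigma>) \<in> span F" using S by (intro span_scale span_base)
        moreover have "\<epsilon> \<sigma> * \<epsilon> \<sigma> = 1" using bspec[OF \<epsilon> \<open>\<sigma> \<in> D\<close>] by auto
        ultimately show "a \<sigma> \<in> span F" by simp
      qed
      then have "card D \<le> dim F"
        using dim_mono[of "a ` D" F] dim_eq_card_independent[OF ind] card_image[OF inj] by simp
      also have "int (dim F) \<le> aff_dim (insert 0 F)"
        using aff_dim_zero[of "insert 0 F"] by (simp add: hull_inc dim_insert span_0)
      also have "\<dots> \<le> aff_dim F + 1" by (simp add: aff_dim_insert)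
      finally have "F facet_of ?P"
        unfolding facet_of_def using face lt affP S[OF \<sigma>0] by auto
      then obtain w where "integral_vector w" "F = ?P \<inter> {x. w \<bullet> x = 1}"
        using refl unfolding reflexive_def by metis
      moreover have "w \<bullet> a \<sigma> = \<epsilon> \<sigma>" if "\<sigma> \<in> D" for \<sigma>
      proof -
        have "\<epsilon> \<sigma> * (w \<bullet> a \<sigma>) = 1" using S[OF that] calculation(2) by auto
        then show ?thesis using bspec[OF \<epsilon> that] by auto
      qed
      ultimately show "\<exists>w. integral_vector w \<and> (\<forall>\<sigma>\<in>D. w \<bullet> a \<sigma> = \<epsilon> \<sigma>)" by blast
    qed
  next
    assume R: ?R
    have "\<exists>w. integral_vector w \<and> ?P \<subseteq> {x. w \<bullet> x \<le> 1} \<and> F = ?P \<inter> {x. w \<bullet> x = 1}"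
      if F: "F facet_of ?P" for F
    proof -
      have face: "F face_of ?P" and "F \<noteq> {}" and affF: "aff_dim F = int (card D) - 1"
        using F affP by (auto simp: facet_of_def)
      have "F \<noteq> ?P" using affF affP by auto
      have "polyhedron ?P" unfolding P using finV by (rule polyhedron_convex_hull)
      then have "F exposed_face_of ?P" using face exposed_face_of_polyhedron by blast
      then obtain u0 b where u0: "?P \<subseteq> {x. u0 \<bullet> x \<le> b}" "F = ?P \<inter> {x. u0 \<bullet> x = b}"
        using \<open>F \<noteq> {}\<close> \<open>F \<noteq> ?P\<close> unfolding exposed_face_of by blast
      \<comment> \<open>At level 0, central symmetry would make \<open>u0\<close> vanish on the
        whole polytope, and the face would not be proper.\<close>
      have "b \<noteq> 0"
      proof
        assume b: "b = 0"
        have "u0 \<bullet> x = 0" if "x \<in> ?P" for x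
        proof -
          have "- x \<in> ?P" using that sym by blast
          then have "u0 \<bullet> x \<le> 0" "u0 \<bullet> - x \<le> 0" using u0(1) that b by blast+
          then show ?thesis by simp
        qed
        then show False using u0(2) b \<open>F \<noteq> ?P\<close> by auto
      qed
      moreover have "b \<ge> 0" using zero u0(1) by force
      ultimately have b: "b > 0" by simp
      define u where "u = (1 / b) *\<^sub>R u0"
      have u: "?P \<subseteq> {x. u \<bullet> x \<le> 1}" "F = ?P \<inter> {x. u \<bullet> x = 1}"
        using u0 b by (auto simp: u_def field_simps)
      obtain S where S: "S \<subseteq> V" "F = convex hull S"
        using face_of_convex_hull_subset[of V F] face finV unfolding P by (metis finite_imp_compact)
      have SF: "u \<bullet> x = 1" if "x \<in> S" for x
      proof -
        have "x \<in> F" using that S(2) hull_inc by metis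
        then show ?thesis using u(2) by simp
      qed
      \<comment> \<open>Vertices of the facet have value 1 under \<open>u\<close>. If
        \<open>u \<bullet> a \<sigma>\<close> were not a sign, neither \<open>a \<sigma>\<close> nor
        its negative would be among them, and the remaining columns would span too little.\<close>
      have sign: "u \<bullet> a \<sigma> \<in> {1, -1}" if \<sigma>: "\<sigma> \<in> D" for \<sigma>
      proof (rule ccontr)
        assume n: "u \<bullet> a \<sigma> \<notin> {1, -1}"
        have "S \<subseteq> span (a ` (D - {\<sigma>}))"
        proof
          fix x assume x: "x \<in> S"
          then obtain \<tau> where \<tau>: "\<tau> \<in> D" "x = a \<tau> \<or> x = - a \<tau>" using S(1) by (auto simp: V_def)
          then have "\<tau> \<noteq> \<sigma>" using n SF[OF x] by auto
          then show "x \<in> span (a ` (D - {\<sigma>}))" using \<tau> by (auto intro: span_base span_neg)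
        qed
        then have "F \<subseteq> span (a ` (D - {\<sigma>}))"
          unfolding S(2) by (intro hull_minimal) (auto intro: subspace_imp_convex)
        then have "dim F \<le> dim (a ` (D - {\<sigma>}))" by (rule dim_mono)
        also have "\<dots> \<le> card (a ` (D - {\<sigma>}))" using fin by (intro dim_le_card') auto
        also have "\<dots> \<le> card (D - {\<sigma>})" using fin by (intro card_image_le) auto
        finally have "dim F \<le> card (D - {\<sigma>})" .
        also have "\<dots> < card D" using fin \<sigma> by (intro psubset_card_mono) auto
        finally have dimF: "int (dim F) < int (card D)" by simp
        have "affine hull F \<subseteq> {x. u \<bullet> x = 1}"
          by (rule hull_minimal) (use u(2) in \<open>auto intro: affine_hyperplane\<close>)
        then have "0 \<notin> affine hull F" by force
        then have "aff_dim (insert 0 F) = int (card D)" using affF by (simp add: aff_dim_insert)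
        moreover have "aff_dim (insert 0 F) = int (dim F)"
          using aff_dim_zero[of "insert 0 F"] by (simp add: hull_inc dim_insert span_0)
        ultimately show False using dimF by simp
      qed
      then obtain w where w: "integral_vector w" "\<forall>\<sigma>\<in>D. w \<bullet> a \<sigma> = u \<bullet> a \<sigma>"
        using R[rule_format, of "\<lambda>\<sigma>. u \<bullet> a \<sigma>"] by blast
      \<comment> \<open>\<open>w\<close> and \<open>u\<close> agree on the columns, hence on the
        polytope, though they may differ as vectors.\<close>
      have "w \<bullet> x = u \<bullet> x" if "x \<in> ?P" for x
      proof -
        have "?P \<subseteq> {x. (w - u) \<bullet> x = 0}"
          using w(2) by (intro hull_minimal convex_hyperplane) (auto simp: inner_diff_left)
        then show ?thesis using that by (auto simp: inner_diff_left)
      qed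
      then show ?thesis using w(1) u by (intro exI[of _ w]) auto
    qed
    then show "reflexive ?P"
      unfolding reflexive_def centrally_symmetric_def using lat sym by blast
  qed
qed

section \<open>Duality with the sign vectors\<close>

text \<open>An integral \<open>w\<close> pairs integrally with the integral vector formed from
  \<open>v\<close>, so every signed sum of \<open>v\<close> is an integer. All signs 1 give the sum
  of \<open>v\<close>; flipping one sign gives twice an entry.\<close>

lemma sign_vectors_imp_half_integral:
  fixes a :: "'b \<Rightarrow> real ^ 'm::finite"
  assumes fin: "finite D"
    and sign: "\<And>\<epsilon>. (\<forall>\<sigma>\<in>D. \<epsilon> \<sigma> \<in> {1, -1}) \<Longrightarrow> \<exists>w. integral_vector w \<and> (\<forall>\<sigma>\<in>D. w \<bullet> a \<sigma> = \<epsilon> \<sigma>)"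
    and v: "integral_vector (\<Sum>\<sigma>\<in>D. v \<sigma> *\<^sub>R a \<sigma>)"
  shows "(\<Sum>\<sigma>\<in>D. v \<sigma>) \<in> \<int>" and "\<sigma> \<in> D \<Longrightarrow> 2 * v \<sigma> \<in> \<int>"
proof -
  have pair: "(\<Sum>\<sigma>\<in>D. v \<sigma> * \<epsilon> \<sigma>) \<in> \<int>" if \<epsilon>: "\<forall>\<sigma>\<in>D. \<epsilon> \<sigma> \<in> {1, -1}" for \<epsilon>
  proof -
    obtain w where w: "integral_vector w" "\<forall>\<sigma>\<in>D. w \<bullet> a \<sigma> = \<epsilon> \<sigma>" using sign[OF \<epsilon>] by blast
    have "w \<bullet> (\<Sum>\<sigma>\<in>D. v \<sigma> *\<^sub>R a \<sigma>) \<in> \<int>"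
      using w(1) v unfolding inner_vec_def integral_vector_def by (intro Ints_sum) auto
    then show ?thesis using w(2) by (simp add: inner_sum_right)
  qed
  show sum: "(\<Sum>\<sigma>\<in>D. v \<sigma>) \<in> \<int>" using pair[of "\<lambda>_. 1"] by simp
  assume \<sigma>: "\<sigma> \<in> D"
  have "(\<Sum>\<tau>\<in>D. v \<tau> * (if \<tau> = \<sigma> then -1 else 1)) = (\<Sum>\<tau>\<in>D. v \<tau>) - 2 * v \<sigma>"
    using fin \<sigma> by (simp add: sum.remove)
  moreover have "(\<Sum>\<tau>\<in>D. v \<tau> * (if \<tau> = \<sigma> then -1 else 1)) \<in> \<int>" by (rule pair) auto
  ultimately show "2 * v \<sigma> \<in> \<int>" using Ints_diff[OF sum] by fastforce
qed

text \<open>If \<open>\<epsilon>\<close> were outside the lattice of values of integral vectors on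
  the columns, \<open>lattice_separation\<close> would give a rational \<open>v\<close> in the dual
  lattice that pairs non-integrally with \<open>\<epsilon>\<close>, against
  \<open>half\<close>.\<close>

lemma half_integral_imp_sign_vectors:
  fixes a :: "'b \<Rightarrow> real ^ 'm::finite"
  assumes fin: "finite D" and int: "\<And>\<sigma>. \<sigma> \<in> D \<Longrightarrow> integral_vector (a \<sigma>)"
    and half: "\<And>v. \<forall>\<sigma>\<in>D. v \<sigma> \<in> \<rat> \<Longrightarrow> integral_vector (\<Sum>\<sigma>\<in>D. v \<sigma> *\<^sub>R a \<sigma>)
      \<Longrightarrow> (\<forall>\<sigma>\<in>D. 2 * v \<sigma> \<in> \<int>) \<and> (\<Sum>\<sigma>\<in>D. v \<sigma>) \<in> \<int>"
    and \<epsilon>: "\<forall>\<sigma>\<in>D. \<epsilon> \<sigma> \<in> {1, -1}"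
  shows "\<exists>w. integral_vector w \<and> (\<forall>\<sigma>\<in>D. w \<bullet> a \<sigma> = \<epsilon> \<sigma>)"
proof -
  have inner_int: "of_int \<lfloor>w \<bullet> a \<sigma>\<rfloor> = w \<bullet> a \<sigma>" if "integral_vector w" "\<sigma> \<in> D" for w \<sigma>
  proof -
    have "w \<bullet> a \<sigma> \<in> \<int>"
      using that int[of \<sigma>] unfolding inner_vec_def integral_vector_def by (intro Ints_sum) auto
    then show ?thesis by simp
  qed
  \<comment> \<open>Extending \<open>a\<close> by zero off \<open>D\<close> makes every floor below
    exact, so that \<open>L\<close> is closed under differences as a set of total functions.\<close>
  define b where "b \<sigma> = (if \<sigma> \<in> D then a \<sigma> else 0)" for \<sigma>
  define L where "L = (\<lambda>w \<sigma>. \<lfloor>w \<bullet> b \<sigma>\<rfloor>) ` {w. integral_vector w}"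
  have inner_int: "of_int \<lfloor>w \<bullet> b \<sigma>\<rfloor> = w \<bullet> b \<sigma>" if "integral_vector w" for w \<sigma>
    using inner_int[OF that] by (simp add: b_def)
  have "\<exists>f\<in>L. \<forall>\<sigma>\<in>D. f \<sigma> = \<lfloor>\<epsilon> \<sigma>\<rfloor>"
  proof (rule ccontr)
    assume neg: "\<not> ?thesis"
    have "\<exists>v. (\<forall>\<sigma>\<in>D. v \<sigma> \<in> \<rat>) \<and> (\<forall>f\<in>L. (\<Sum>\<sigma>\<in>D. v \<sigma> * of_int (f \<sigma>)) \<in> \<int>)
      \<and> (\<Sum>\<sigma>\<in>D. v \<sigma> * of_int \<lfloor>\<epsilon> \<sigma>\<rfloor> :: real) \<notin> \<int>"
    proof (rule lattice_separation[OF fin _ _ neg])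
      show "L \<noteq> {}" by (auto simp: L_def integral_vector_def intro!: exI[of _ 0])
      show "(\<lambda>\<sigma>. f \<sigma> - g \<sigma>) \<in> L" if fg: "f \<in> L" "g \<in> L" for f g
      proof -
        obtain w w' where w: "integral_vector w" "integral_vector w'"
          "f = (\<lambda>\<sigma>. \<lfloor>w \<bullet> b \<sigma>\<rfloor>)" "g = (\<lambda>\<sigma>. \<lfloor>w' \<bullet> b \<sigma>\<rfloor>)" using fg by (auto simp: L_def)
        have ww: "integral_vector (w - w')" using w by (auto simp: integral_vector_def)
        have "real_of_int \<lfloor>(w - w') \<bullet> b \<sigma>\<rfloor> = real_of_int (\<lfloor>w \<bullet> b \<sigma>\<rfloor> - \<lfloor>w' \<bullet> b \<sigma>\<rfloor>)" for \<sigma>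
          unfolding of_int_diff inner_int[OF ww] inner_int[OF w(1)] inner_int[OF w(2)]
          by (rule inner_diff_left)
        then have "(\<lambda>\<sigma>. f \<sigma> - g \<sigma>) = (\<lambda>\<sigma>. \<lfloor>(w - w') \<bullet> b \<sigma>\<rfloor>)"
          using w(3,4) of_int_eq_iff by metis
        then show ?thesis using ww unfolding L_def by blast
      qed
    qed
    then obtain v where v: "\<forall>\<sigma>\<in>D. v \<sigma> \<in> \<rat>" "\<forall>f\<in>L. (\<Sum>\<sigma>\<in>D. v \<sigma> * of_int (f \<sigma>)) \<in> \<int>"
      "(\<Sum>\<sigma>\<in>D. v \<sigma> * of_int \<lfloor>\<epsilon> \<sigma>\<rfloor> :: real) \<notin> \<int>" by blast
    have "integral_vector (\<Sum>\<sigma>\<in>D. v \<sigma> *\<^sub>R a \<sigma>)"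
      unfolding integral_vector_def
    proof
      fix i :: 'm
      \<comment> \<open>Pairing with the unit vectors, which are integral, reads off the coordinates
        of the combination.\<close>
      have iv: "integral_vector (axis i 1 :: real ^ 'm)" by (auto simp: integral_vector_def axis_def)
      then have "(\<Sum>\<sigma>\<in>D. v \<sigma> * of_int \<lfloor>axis i 1 \<bullet> b \<sigma>\<rfloor>) \<in> \<int>" using v(2) by (auto simp: L_def)
      also have "(\<Sum>\<sigma>\<in>D. v \<sigma> * of_int \<lfloor>axis i 1 \<bullet> b \<sigma>\<rfloor>) = (\<Sum>\<sigma>\<in>D. v \<sigma> *\<^sub>R a \<sigma>) $ i"
        unfolding inner_int[OF iv]
        by (simp add: b_def cart_eq_inner_axis inner_sum_right inner_commute)
      finally show "(\<Sum>\<sigma>\<in>D. v \<sigma> *\<^sub>R a \<sigma>) $ i \<in> \<int>" .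
    qed
    with half v(1) have h: "\<forall>\<sigma>\<in>D. 2 * v \<sigma> \<in> \<int>" "(\<Sum>\<sigma>\<in>D. v \<sigma>) \<in> \<int>" by blast+
    \<comment> \<open>Every sign differs from 1 by 0 or -2, so this pairing differs from the sum of
      \<open>v\<close> by entries of \<open>2 v\<close>.\<close>
    have "(\<Sum>\<sigma>\<in>D. v \<sigma> * of_int \<lfloor>\<epsilon> \<sigma>\<rfloor>) = (\<Sum>\<sigma>\<in>D. v \<sigma>) + (\<Sum>\<sigma>\<in>D. v \<sigma> * (of_int \<lfloor>\<epsilon> \<sigma>\<rfloor> - 1))"
      by (simp add: algebra_simps flip: sum.distrib)
    moreover have "(\<Sum>\<sigma>\<in>D. v \<sigma> * (of_int \<lfloor>\<epsilon> \<sigma>\<rfloor> - 1)) \<in> \<int>"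
    proof (rule Ints_sum)
      fix \<sigma> assume "\<sigma> \<in> D"
      then show "v \<sigma> * (of_int \<lfloor>\<epsilon> \<sigma>\<rfloor> - 1) \<in> \<int>"
        using bspec[OF \<epsilon>] Ints_minus[OF bspec[OF h(1)]] by (fastforce simp: mult.commute)
    qed
    ultimately show False using v(3) Ints_add[OF h(2)] by simp
  qed
  then obtain w where w: "integral_vector w" "\<forall>\<sigma>\<in>D. \<lfloor>w \<bullet> b \<sigma>\<rfloor> = \<lfloor>\<epsilon> \<sigma>\<rfloor>" by (auto simp: L_def)
  have "w \<bullet> a \<sigma> = \<epsilon> \<sigma>" if \<sigma>: "\<sigma> \<in> D" for \<sigma>
  proof -
    have "w \<bullet> b \<sigma> = of_int \<lfloor>\<epsilon> \<sigma>\<rfloor>" using inner_int[OF w(1)] w(2) \<sigma> by metis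
    moreover obtain k where "\<epsilon> \<sigma> = of_int k"
      using bspec[OF \<epsilon> \<sigma>] by (metis Ints_1 Ints_cases Ints_minus insertE singletonD)
    ultimately show ?thesis using \<sigma> by (simp add: b_def)
  qed
  then show ?thesis using w(1) by blast
qed

section \<open>Homology of a simplicial complex\<close>

lemma carrier_chain_group [simp]: "carrier (chain_group \<Delta> j) = faces \<Delta> j \<rightarrow>\<^sub>E UNIV"
  by (simp add: chain_group_def)

lemma mult_chain_group [simp]: "x \<otimes>\<^bsub>chain_group \<Delta> j\<^esub> y = (\<lambda>\<tau>\<in>faces \<Delta> j. x \<tau> + y \<tau>)"
  by (simp add: chain_group_def)

lemma one_chain_group [simp]: "\<one>\<^bsub>chain_group \<Delta> j\<^esub> = (\<lambda>\<tau>\<in>faces \<Delta> j. 0)"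
  by (simp add: chain_group_def)

lemma comm_group_chain_group: "comm_group (chain_group \<Delta> j)"
proof (rule group.group_comm_groupI)
  show "group (chain_group \<Delta> j)" by (simp add: chain_group_def)
qed (auto simp: restrict_def add.commute)

locale simplicial_complex =
  fixes n :: nat and \<Delta> :: "nat set set"
  assumes complex: "abstract_simplicial_complex n \<Delta>"
begin

lemma finite_complex: "finite \<Delta>"
  using complex finite_subset[of \<Delta> "Pow {1..n}"] by (simp add: abstract_simplicial_complex_def)

lemma finite_faces: "finite (faces \<Delta> j)"
  using finite_complex by (simp add: faces_def)

lemma finite_face: "\<sigma> \<in> faces \<Delta> j \<Longrightarrow> finite \<sigma>"
  by (rule card_ge_0_finite) (simp add: faces_def)

lemma face_Diff_singleton:
  assumes "\<sigma> \<in> faces \<Delta> (Suc j)" "x \<in> \<sigma>"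
  shows "\<sigma> - {x} \<in> faces \<Delta> j"
  using assms complex finite_face[OF assms(1)]
  by (auto simp: faces_def abstract_simplicial_complex_def card_Diff_singleton)

lemma boundary_hom: "boundary \<Delta> j \<in> hom (chain_group \<Delta> j) (chain_group \<Delta> (j - 1))"
  by (rule homI) (auto simp: boundary_def restrict_def algebra_simps sum.distrib fun_eq_iff)

lemma group_hom_boundary: "group_hom (chain_group \<Delta> j) (chain_group \<Delta> (j - 1)) (boundary \<Delta> j)"
  using boundary_hom comm_group_chain_group
  by (simp add: group_hom_def group_hom_axioms_def comm_group_def)

lemma boundary_boundary:
  fixes c :: "nat set \<Rightarrow> int"
  assumes "j > 0"
  shows "boundary \<Delta> j (boundary \<Delta> (Suc j) c) = (\<lambda>\<tau>\<in>faces \<Delta> (j - 1). 0)"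
proof
  fix \<omega>
  show "boundary \<Delta> j (boundary \<Delta> (Suc j) c) \<omega> = (\<lambda>\<tau>\<in>faces \<Delta> (j - 1). 0) \<omega>"
  proof (cases "\<omega> \<in> faces \<Delta> (j - 1)")
    case True
    have "boundary \<Delta> j (boundary \<Delta> (Suc j) c) \<omega> =
        (\<Sum>\<tau>\<in>faces \<Delta> j. incidence \<omega> \<tau> * (\<Sum>\<sigma>\<in>faces \<Delta> (Suc j). incidence \<tau> \<sigma> * c \<sigma>))"
      using True by (simp add: boundary_def)
    also have "\<dots> = (\<Sum>\<tau>\<in>faces \<Delta> j. \<Sum>\<sigma>\<in>faces \<Delta> (Suc j). c \<sigma> * (incidence \<tau> \<sigma> * incidence \<omega> \<tau>))"
      by (simp add: sum_distrib_left algebra_simps)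
    also have "\<dots> = (\<Sum>\<sigma>\<in>faces \<Delta> (Suc j). c \<sigma> * (\<Sum>\<tau>\<in>faces \<Delta> j. incidence \<tau> \<sigma> * incidence \<omega> \<tau>))"
      by (subst sum.swap) (simp add: sum_distrib_left)
    also have "\<dots> = 0"
      using incidence_incidence[OF finite_face finite_faces face_Diff_singleton] by (intro sum.neutral) simp
    finally show ?thesis using True by simp
  qed (simp add: boundary_def)
qed

lemma subgroup_cycles: "subgroup (cycles \<Delta> j) (chain_group \<Delta> j)"
proof (cases "j = 0")
  case True
  have "group (chain_group \<Delta> 0)" using comm_group_chain_group comm_group_def by blast
  from group.subgroup_self[OF this] show ?thesis using True by (simp add: cycles_def)
next
  case False
  then show ?thesis using group_hom.subgroup_kernel[OF group_hom_boundary[of j]] by (simp add: cycles_def)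
qed

lemma subgroup_boundaries: "subgroup (boundaries \<Delta> j) (chain_group \<Delta> j)"
  using group_hom.img_is_subgroup[OF group_hom_boundary[of "j + 1"]] by (simp add: boundaries_def)

lemma boundaries_subset_cycles: "boundaries \<Delta> j \<subseteq> cycles \<Delta> j"
proof (cases "j = 0")
  case True
  then show ?thesis using subgroup.subset[OF subgroup_boundaries[of 0]] by (simp add: cycles_def)
next
  case False
  then show ?thesis using subgroup.subset[OF subgroup_boundaries[of j]] boundary_boundary[of j]
    by (auto simp: cycles_def kernel_def boundaries_def)
qed

lemma carrier_cycle_group [simp]: "carrier (cycle_group \<Delta> j) = cycles \<Delta> j"
  by (simp add: cycle_group_def)

lemma mult_cycle_group [simp]: "x \<otimes>\<^bsub>cycle_group \<Delta> j\<^esub> y = (\<lambda>\<tau>\<in>faces \<Delta> j. x \<tau> + y \<tau>)"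
  by (simp add: cycle_group_def)

lemma one_cycle_group [simp]: "\<one>\<^bsub>cycle_group \<Delta> j\<^esub> = (\<lambda>\<tau>\<in>faces \<Delta> j. 0)"
  by (simp add: cycle_group_def)

lemma cycles_extensional: "z \<in> cycles \<Delta> j \<Longrightarrow> z \<in> faces \<Delta> j \<rightarrow>\<^sub>E UNIV"
  using subgroup.subset[OF subgroup_cycles[of j]] by auto

lemma comm_group_cycle_group: "comm_group (cycle_group \<Delta> j)"
proof (rule group.group_comm_groupI)
  show "group (cycle_group \<Delta> j)" unfolding cycle_group_def
    using subgroup_cycles comm_group_chain_group comm_group_def subgroup.subgroup_is_group by blast
qed (simp add: add.commute)

lemma subgroup_boundaries_cycle_group: "subgroup (boundaries \<Delta> j) (cycle_group \<Delta> j)"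
  unfolding cycle_group_def
  using comm_group_chain_group comm_group_def group.subgroup_incl subgroup_boundaries subgroup_cycles
    boundaries_subset_cycles by metis

lemma normal_boundaries: "boundaries \<Delta> j \<lhd> cycle_group \<Delta> j"
  using comm_group.subgroup_imp_normal[OF comm_group_cycle_group subgroup_boundaries_cycle_group] .

section \<open>Homology classes and their representatives\<close>

lemma group_homology: "group (homology \<Delta> j)"
  unfolding homology_def by (rule normal.factorgroup_is_group[OF normal_boundaries])

lemma carrier_homology: "carrier (homology \<Delta> j) = homology_class \<Delta> j ` cycles \<Delta> j"
  by (simp add: homology_def carrier_FactGroup homology_class_def)

lemma one_homology: "\<one>\<^bsub>homology \<Delta> j\<^esub> = boundaries \<Delta> j"
  by (simp add: homology_def)

lemma homology_class_add:
  assumes "x \<in> cycles \<Delta> j" "y \<in> cycles \<Delta> j"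
  shows "homology_class \<Delta> j x \<otimes>\<^bsub>homology \<Delta> j\<^esub> homology_class \<Delta> j y = homology_class \<Delta> j (\<lambda>\<tau>\<in>faces \<Delta> j. x \<tau> + y \<tau>)"
  using normal.rcos_sum[OF normal_boundaries] assms by (simp add: homology_def homology_class_def)

lemma pow_cycle_group:
  assumes "x \<in> cycles \<Delta> j"
  shows "x [^]\<^bsub>cycle_group \<Delta> j\<^esub> (k::nat) = (\<lambda>\<tau>\<in>faces \<Delta> j. int k * x \<tau>)"
  by (induction k) (auto simp: restrict_def algebra_simps fun_eq_iff)

lemma homology_class_pow:
  assumes "x \<in> cycles \<Delta> j"
  shows "homology_class \<Delta> j x [^]\<^bsub>homology \<Delta> j\<^esub> (k::nat) = homology_class \<Delta> j (\<lambda>\<tau>\<in>faces \<Delta> j. int k * x \<tau>)"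
  using normal.FactGroup_pow[OF normal_boundaries, of x j k] assms
  by (simp add: homology_def homology_class_def pow_cycle_group)

lemma homology_class_eq_boundaries_iff:
  assumes "x \<in> cycles \<Delta> j"
  shows "homology_class \<Delta> j x = boundaries \<Delta> j \<longleftrightarrow> x \<in> boundaries \<Delta> j"
  using assms group.coset_join1[OF _ _ _ subgroup_boundaries_cycle_group]
    group.coset_join2[OF _ _ subgroup_boundaries_cycle_group]
    comm_group_cycle_group comm_group_def
  unfolding homology_class_def by (metis carrier_cycle_group)

lemma mem_homology_class:
  "y \<in> homology_class \<Delta> j x \<longleftrightarrow> (\<exists>b\<in>boundaries \<Delta> j. y = (\<lambda>\<tau>\<in>faces \<Delta> j. b \<tau> + x \<tau>))"
  by (simp add: homology_class_def r_coset_def)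

lemma homology_class_eqI:
  assumes "x \<in> cycles \<Delta> j" "b \<in> boundaries \<Delta> j" "y = (\<lambda>\<tau>\<in>faces \<Delta> j. b \<tau> + x \<tau>)"
  shows "homology_class \<Delta> j x = homology_class \<Delta> j y"
proof -
  have "y \<in> boundaries \<Delta> j #>\<^bsub>cycle_group \<Delta> j\<^esub> x"
    using mem_homology_class[of y j x] assms by (auto simp: homology_class_def)
  then show ?thesis unfolding homology_class_def
    using assms(1) comm_group_cycle_group
    by (intro group.repr_independence subgroup_boundaries_cycle_group) (auto simp: comm_group_def)
qed

text \<open>Stated for arbitrary chains: the \<open>z i\<close> of the theorem are not known to be
  cycles, and membership in their own class is what shows that they are.\<close>

lemma homology_class_self:
  assumes "x \<in> faces \<Delta> j \<rightarrow>\<^sub>E UNIV"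
  shows "x \<in> homology_class \<Delta> j x"
  unfolding mem_homology_class using assms subgroup.one_closed[OF subgroup_boundaries[of j]]
  by (intro bexI[of _ "\<lambda>\<tau>\<in>faces \<Delta> j. 0"]) (auto simp: PiE_def extensional_def fun_eq_iff)

lemma homology_class_eqD:
  assumes "x \<in> cycles \<Delta> j" "homology_class \<Delta> j x = homology_class \<Delta> j y"
  shows "\<exists>b\<in>boundaries \<Delta> j. x = (\<lambda>\<tau>\<in>faces \<Delta> j. b \<tau> + y \<tau>)"
  using homology_class_self[OF cycles_extensional[OF assms(1)]] assms(2) mem_homology_class by simp

lemma cycles_iff:
  "z \<in> cycles \<Delta> j \<longleftrightarrow> z \<in> faces \<Delta> j \<rightarrow>\<^sub>E UNIV \<and>
    (j > 0 \<longrightarrow> (\<forall>\<omega>\<in>faces \<Delta> (j - 1). (\<Sum>\<tau>\<in>faces \<Delta> j. incidence \<omega> \<tau> * z \<tau>) = 0))"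
  by (auto simp: cycles_def kernel_def boundary_def fun_eq_iff restrict_def)

lemma boundaries_eq_range: "boundaries \<Delta> j = range (boundary \<Delta> (j + 1))"
proof -
  have "boundary \<Delta> (j + 1) c \<in> boundaries \<Delta> j" for c :: "nat set \<Rightarrow> int"
  proof -
    have "boundary \<Delta> (j + 1) c = boundary \<Delta> (j + 1) (restrict c (faces \<Delta> (j + 1)))"
      by (simp add: boundary_def cong: restrict_cong)
    then show ?thesis by (simp add: boundaries_def)
  qed
  then show ?thesis by (auto simp: boundaries_def)
qed

lemma boundaries_zero: "(\<lambda>\<tau>\<in>faces \<Delta> j. 0) \<in> boundaries \<Delta> j"
  using subgroup.one_closed[OF subgroup_boundaries[of j]] by simp

lemma boundaries_add:
  assumes "x \<in> boundaries \<Delta> j" "y \<in> boundaries \<Delta> j"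
  shows "(\<lambda>\<tau>\<in>faces \<Delta> j. x \<tau> + y \<tau>) \<in> boundaries \<Delta> j"
  using subgroup.m_closed[OF subgroup_boundaries[of j] assms] by simp

lemma boundaries_mult:
  assumes "x \<in> boundaries \<Delta> j"
  shows "(\<lambda>\<tau>\<in>faces \<Delta> j. k * x \<tau>) \<in> boundaries \<Delta> j"
proof -
  obtain c where "x = boundary \<Delta> (j + 1) c" using assms by (auto simp: boundaries_eq_range)
  then have "(\<lambda>\<tau>\<in>faces \<Delta> j. k * x \<tau>) = boundary \<Delta> (j + 1) (\<lambda>\<sigma>. k * c \<sigma>)"
    by (auto simp: boundary_def sum_distrib_left fun_eq_iff algebra_simps)
  then show ?thesis by (simp add: boundaries_eq_range)
qed

lemma boundaries_sum:
  assumes "finite I" "\<And>i. i \<in> I \<Longrightarrow> (\<lambda>\<tau>\<in>faces \<Delta> j. x i \<tau>) \<in> boundaries \<Delta> j"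
  shows "(\<lambda>\<tau>\<in>faces \<Delta> j. \<Sum>i\<in>I. x i \<tau>) \<in> boundaries \<Delta> j"
  using assms
proof (induction I rule: finite_induct)
  case empty
  then show ?case using boundaries_zero[of j] by (simp add: restrict_def)
next
  case (insert i I)
  have "(\<lambda>\<tau>\<in>faces \<Delta> j. x i \<tau>) \<in> boundaries \<Delta> j" using insert.prems by blast
  moreover have "(\<lambda>\<tau>\<in>faces \<Delta> j. \<Sum>i\<in>I. x i \<tau>) \<in> boundaries \<Delta> j"
    using insert.IH insert.prems by blast
  ultimately have "(\<lambda>\<tau>\<in>faces \<Delta> j. (\<lambda>\<tau>\<in>faces \<Delta> j. x i \<tau>) \<tau> + (\<lambda>\<tau>\<in>faces \<Delta> j. \<Sum>i\<in>I. x i \<tau>) \<tau>) \<in> boundaries \<Delta> j"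
    by (rule boundaries_add)
  then show ?case using insert.hyps by (simp add: restrict_def cong: if_cong)
qed

lemma cycles_lincomb:
  assumes "finite I" "\<And>i. i \<in> I \<Longrightarrow> x i \<in> cycles \<Delta> j"
  shows "(\<lambda>\<tau>\<in>faces \<Delta> j. \<Sum>i\<in>I. m i * x i \<tau>) \<in> cycles \<Delta> j"
  unfolding cycles_iff
proof (intro conjI impI ballI)
  fix \<omega> assume "j > 0" "\<omega> \<in> faces \<Delta> (j - 1)"
  then have 0: "(\<Sum>\<tau>\<in>faces \<Delta> j. incidence \<omega> \<tau> * x i \<tau>) = 0" if "i \<in> I" for i
    using assms(2)[OF that] by (simp add: cycles_iff)
  have "(\<Sum>\<tau>\<in>faces \<Delta> j. incidence \<omega> \<tau> * (\<lambda>\<tau>\<in>faces \<Delta> j. \<Sum>i\<in>I. m i * x i \<tau>) \<tau>)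
      = (\<Sum>\<tau>\<in>faces \<Delta> j. \<Sum>i\<in>I. m i * (incidence \<omega> \<tau> * x i \<tau>))"
    by (simp add: sum_distrib_left algebra_simps)
  also have "\<dots> = (\<Sum>i\<in>I. m i * (\<Sum>\<tau>\<in>faces \<Delta> j. incidence \<omega> \<tau> * x i \<tau>))"
    by (subst sum.swap) (simp add: sum_distrib_left)
  also have "\<dots> = 0" using 0 by simp
  finally show "(\<Sum>\<tau>\<in>faces \<Delta> j. incidence \<omega> \<tau> * (\<lambda>\<tau>\<in>faces \<Delta> j. \<Sum>i\<in>I. m i * x i \<tau>) \<tau>) = 0" .
qed auto

lemma cycles_add:
  "x \<in> cycles \<Delta> j \<Longrightarrow> y \<in> cycles \<Delta> j \<Longrightarrow> (\<lambda>\<tau>\<in>faces \<Delta> j. x \<tau> + y \<tau>) \<in> cycles \<Delta> j"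
  using subgroup.m_closed[OF subgroup_cycles[of j]] by simp

lemma cycles_mult:
  "x \<in> cycles \<Delta> j \<Longrightarrow> (\<lambda>\<tau>\<in>faces \<Delta> j. k * x \<tau>) \<in> cycles \<Delta> j"
  using cycles_lincomb[of "{()}" "\<lambda>_. x" j "\<lambda>_. k"] by simp

lemma cycles_diff:
  assumes "x \<in> cycles \<Delta> j" "y \<in> cycles \<Delta> j"
  shows "(\<lambda>\<tau>\<in>faces \<Delta> j. x \<tau> - y \<tau>) \<in> cycles \<Delta> j"
  using cycles_add[OF assms(1) cycles_mult[OF assms(2), of "-1"]] by (simp cong: restrict_cong)

lemma boundaries_diff:
  assumes "x \<in> boundaries \<Delta> j" "y \<in> boundaries \<Delta> j"
  shows "(\<lambda>\<tau>\<in>faces \<Delta> j. x \<tau> - y \<tau>) \<in> boundaries \<Delta> j"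
  using boundaries_add[OF assms(1) boundaries_mult[OF assms(2), of "-1"]] by (simp cong: restrict_cong)

text \<open>The factor \<open>k\<close> cancels from each equation of the kernel; in particular a
  chain with a bounding nonzero multiple is a cycle.\<close>

lemma cycles_saturated:
  assumes "z \<in> faces \<Delta> j \<rightarrow>\<^sub>E UNIV" "k \<noteq> 0" "(\<lambda>\<tau>\<in>faces \<Delta> j. k * z \<tau>) \<in> cycles \<Delta> j"
  shows "z \<in> cycles \<Delta> j"
  using assms unfolding cycles_iff
  by (simp add: mult.left_commute[of _ k] flip: sum_distrib_left)

lemma comm_group_homology: "comm_group (homology \<Delta> j)"
  unfolding homology_def
  by (rule comm_group.abelian_FactGroup[OF comm_group_cycle_group subgroup_boundaries_cycle_group])

lemma homology_class_eq_iff: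
  assumes "x \<in> cycles \<Delta> j" "y \<in> cycles \<Delta> j"
  shows "homology_class \<Delta> j x = homology_class \<Delta> j y \<longleftrightarrow> (\<lambda>\<tau>\<in>faces \<Delta> j. x \<tau> - y \<tau>) \<in> boundaries \<Delta> j"
proof
  assume "homology_class \<Delta> j x = homology_class \<Delta> j y"
  then obtain b where b: "b \<in> boundaries \<Delta> j" "x = (\<lambda>\<tau>\<in>faces \<Delta> j. b \<tau> + y \<tau>)"
    using homology_class_eqD[OF assms(1)] by blast
  have "(\<lambda>\<tau>\<in>faces \<Delta> j. x \<tau> - y \<tau>) = b"
    using b(2) cycles_extensional[OF subsetD[OF boundaries_subset_cycles b(1)]]
    by (auto simp: fun_eq_iff PiE_def extensional_def)
  then show "(\<lambda>\<tau>\<in>faces \<Delta> j. x \<tau> - y \<tau>) \<in> boundaries \<Delta> j" using b(1) by simp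
next
  assume b: "(\<lambda>\<tau>\<in>faces \<Delta> j. x \<tau> - y \<tau>) \<in> boundaries \<Delta> j"
  have "x = (\<lambda>\<tau>\<in>faces \<Delta> j. (\<lambda>\<tau>\<in>faces \<Delta> j. x \<tau> - y \<tau>) \<tau> + y \<tau>)"
    using cycles_extensional[OF assms(1)] by (auto simp: fun_eq_iff PiE_def extensional_def)
  from homology_class_eqI[OF assms(2) b this] show "homology_class \<Delta> j x = homology_class \<Delta> j y" by simp
qed

section \<open>Decomposing homology along representing cycles\<close>

definition generator_comb ::
  "nat \<Rightarrow> nat \<Rightarrow> nat \<Rightarrow> (nat \<Rightarrow> nat set \<Rightarrow> int) \<Rightarrow> (nat \<Rightarrow> nat set \<Rightarrow> int) \<Rightarrow> (nat \<Rightarrow> int) \<Rightarrow> (nat \<Rightarrow> int) \<Rightarrow> nat set \<Rightarrow> int"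
  where "generator_comb j l r x y p q =
    (\<lambda>\<tau>\<in>faces \<Delta> j. (\<Sum>i<l. p i * x i \<tau>) + (\<Sum>i<r. q i * y i \<tau>))"

text \<open>The classes of the \<open>x i\<close> and \<open>y i\<close> generate homology, and
  their only relations are those forced by \<open>2 y i\<close> bounding. Stated on cycles, it
  carries the representatives that the isomorphism type alone would lose and that condition (3)
  needs.\<close>

definition free_plus_Z2_basis ::
  "nat \<Rightarrow> nat \<Rightarrow> nat \<Rightarrow> (nat \<Rightarrow> nat set \<Rightarrow> int) \<Rightarrow> (nat \<Rightarrow> nat set \<Rightarrow> int) \<Rightarrow> bool" where
  "free_plus_Z2_basis j l r x y \<longleftrightarrow>
     (\<forall>i<l. x i \<in> cycles \<Delta> j) \<and> (\<forall>i<r. y i \<in> cycles \<Delta> j) \<and>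
     (\<forall>i<r. (\<lambda>\<tau>\<in>faces \<Delta> j. 2 * y i \<tau>) \<in> boundaries \<Delta> j) \<and>
     (\<forall>z\<in>cycles \<Delta> j. \<exists>p q. (\<lambda>\<tau>\<in>faces \<Delta> j. z \<tau> - generator_comb j l r x y p q \<tau>) \<in> boundaries \<Delta> j) \<and>
     (\<forall>p q. generator_comb j l r x y p q \<in> boundaries \<Delta> j \<longrightarrow> (\<forall>i<l. p i = 0) \<and> (\<forall>i<r. even (q i)))"

context
  fixes j l r x y
  assumes basis: "free_plus_Z2_basis j l r x y"
begin

lemma generator_comb_cycle: "generator_comb j l r x y p q \<in> cycles \<Delta> j"
proof -
  have "(\<lambda>\<tau>\<in>faces \<Delta> j. \<Sum>i<l. p i * x i \<tau>) \<in> cycles \<Delta> j" "(\<lambda>\<tau>\<in>faces \<Delta> j. \<Sum>i<r. q i * y i \<tau>) \<in> cycles \<Delta> j"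
    using basis by (auto simp: free_plus_Z2_basis_def intro!: cycles_lincomb)
  from cycles_add[OF this] show ?thesis by (simp add: generator_comb_def cong: restrict_cong)
qed

lemma even_generator_comb_boundary:
  assumes "\<And>i. i < l \<Longrightarrow> p i = 0" "\<And>i. i < r \<Longrightarrow> even (q i)"
  shows "generator_comb j l r x y p q \<in> boundaries \<Delta> j"
proof -
  have "(\<lambda>\<tau>\<in>faces \<Delta> j. \<Sum>i<r. q i * y i \<tau>) \<in> boundaries \<Delta> j"
  proof (rule boundaries_sum)
    fix i assume "i \<in> {..<r}"
    then have "(\<lambda>\<tau>\<in>faces \<Delta> j. 2 * y i \<tau>) \<in> boundaries \<Delta> j" "even (q i)"
      using basis assms by (auto simp: free_plus_Z2_basis_def)
    from boundaries_mult[OF this(1), of "q i div 2"] this(2)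
    show "(\<lambda>\<tau>\<in>faces \<Delta> j. q i * y i \<tau>) \<in> boundaries \<Delta> j"
      by (simp add: mult.assoc[symmetric] cong: restrict_cong)
  qed simp
  then show ?thesis using assms(1) by (simp add: generator_comb_def)
qed

lemma generator_comb_diff:
  "(\<lambda>\<tau>\<in>faces \<Delta> j. generator_comb j l r x y p q \<tau> - generator_comb j l r x y p' q' \<tau>)
    = generator_comb j l r x y (\<lambda>i. p i - p' i) (\<lambda>i. q i - q' i)"
  by (auto simp: generator_comb_def fun_eq_iff algebra_simps sum_subtractf)

text \<open>Serves in both directions: from right to left it makes the class insensitive to reducing
  \<open>q\<close> modulo 2 and to values outside the index range, from left to right it gives
  injectivity of the isomorphism.\<close>

lemma generator_class_eq_iff:
  "homology_class \<Delta> j (generator_comb j l r x y p q) = homology_class \<Delta> j (generator_comb j l r x y p' q')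
    \<longleftrightarrow> (\<forall>i<l. p i = p' i) \<and> (\<forall>i<r. even (q i - q' i))"
  unfolding homology_class_eq_iff[OF generator_comb_cycle generator_comb_cycle] generator_comb_diff
  using even_generator_comb_boundary[of "\<lambda>i. p i - p' i" "\<lambda>i. q i - q' i"] basis
  unfolding free_plus_Z2_basis_def by fastforce

lemma generator_class_exists:
  assumes "z \<in> cycles \<Delta> j"
  obtains p q where "homology_class \<Delta> j z = homology_class \<Delta> j (generator_comb j l r x y p q)"
proof -
  have "\<exists>p q. (\<lambda>\<tau>\<in>faces \<Delta> j. z \<tau> - generator_comb j l r x y p q \<tau>) \<in> boundaries \<Delta> j"
    using basis assms by (auto simp: free_plus_Z2_basis_def)
  then show thesis using that homology_class_eq_iff[OF assms generator_comb_cycle] by blast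
qed

lemma homology_iso_free_plus_Z2: "homology \<Delta> j \<cong> free_plus_Z2 l r"
proof -
  \<comment> \<open>The map starts at the concrete group, whose elements come with coefficients;
    from the other side coefficients would have to be chosen.\<close>
  define \<phi> where "\<phi> = (\<lambda>(p, q). homology_class \<Delta> j (generator_comb j l r x y p q))"
  have "\<phi> \<in> hom (free_plus_Z2 l r) (homology \<Delta> j)"
  proof (rule homI)
    fix g assume "g \<in> carrier (free_plus_Z2 l r)"
    then show "\<phi> g \<in> carrier (homology \<Delta> j)"
      using generator_comb_cycle by (auto simp: \<phi>_def carrier_homology split: prod.splits)
  next
    fix g h assume "g \<in> carrier (free_plus_Z2 l r)" "h \<in> carrier (free_plus_Z2 l r)"
    obtain p q p' q' where gh: "g = (p, q)" "h = (p', q')" by (cases g, cases h)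
    have sum: "(\<lambda>\<tau>\<in>faces \<Delta> j. generator_comb j l r x y p q \<tau> + generator_comb j l r x y p' q' \<tau>)
       = generator_comb j l r x y (\<lambda>i. p i + p' i) (\<lambda>i. q i + q' i)"
      by (auto simp: generator_comb_def fun_eq_iff algebra_simps sum.distrib)
    have "\<phi> (g \<otimes>\<^bsub>free_plus_Z2 l r\<^esub> h) = homology_class \<Delta> j (generator_comb j l r x y
        (\<lambda>i\<in>{..<l}. p i + p' i) (\<lambda>i\<in>{..<r}. (q i + q' i) mod 2))"
      by (simp add: \<phi>_def gh free_plus_Z2_def)
    also have "\<dots> = homology_class \<Delta> j (generator_comb j l r x y (\<lambda>i. p i + p' i) (\<lambda>i. q i + q' i))"
      unfolding generator_class_eq_iff by simp
    also have "\<dots> = \<phi> g \<otimes>\<^bsub>homology \<Delta> j\<^esub> \<phi> h"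
      by (simp add: \<phi>_def gh homology_class_add generator_comb_cycle sum)
    finally show "\<phi> (g \<otimes>\<^bsub>free_plus_Z2 l r\<^esub> h) = \<phi> g \<otimes>\<^bsub>homology \<Delta> j\<^esub> \<phi> h" .
  qed
  moreover have "bij_betw \<phi> (carrier (free_plus_Z2 l r)) (carrier (homology \<Delta> j))"
    unfolding bij_betw_def
  proof
    have mod2: "a = b" if "a \<in> {0..<2}" "b \<in> {0..<2}" "even (a - b)" for a b :: int
    proof -
      have "a = 0 \<or> a = 1" "b = 0 \<or> b = 1" using that by auto
      then show ?thesis using that(3) by auto
    qed
    show "inj_on \<phi> (carrier (free_plus_Z2 l r))"
    proof (rule inj_onI)
      fix g h assume gh: "g \<in> carrier (free_plus_Z2 l r)" "h \<in> carrier (free_plus_Z2 l r)" "\<phi> g = \<phi> h"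
      obtain p q p' q' where e: "g = (p, q)" "h = (p', q')" by (cases g, cases h)
      have c: "p \<in> {..<l} \<rightarrow>\<^sub>E UNIV" "p' \<in> {..<l} \<rightarrow>\<^sub>E UNIV" "q \<in> {..<r} \<rightarrow>\<^sub>E {0..<2}" "q' \<in> {..<r} \<rightarrow>\<^sub>E {0..<2}"
        using gh(1,2) by (auto simp: e free_plus_Z2_def carrier_integer_mod_group)
      have pq: "(\<forall>i<l. p i = p' i) \<and> (\<forall>i<r. even (q i - q' i))"
        using gh(3) by (simp only: \<phi>_def e prod.case generator_class_eq_iff)
      then have ev: "even (q i - q' i)" if "i < r" for i using that by blast
      from pq have eq: "p i = p' i" if "i < l" for i using that by blast
      have "p = p'" by (rule PiE_ext[OF c(1,2)]) (simp add: eq)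
      moreover have "q = q'"
      proof (rule PiE_ext[OF c(3,4)])
        fix i assume i: "i \<in> {..<r}"
        show "q i = q' i"
          by (rule mod2[OF PiE_mem[OF c(3) i] PiE_mem[OF c(4) i]]) (use ev i in simp)
      qed
      ultimately show "g = h" by (simp add: e)
    qed
    show "\<phi> ` carrier (free_plus_Z2 l r) = carrier (homology \<Delta> j)"
    proof
      show "\<phi> ` carrier (free_plus_Z2 l r) \<subseteq> carrier (homology \<Delta> j)"
        using generator_comb_cycle by (auto simp: \<phi>_def carrier_homology)
      show "carrier (homology \<Delta> j) \<subseteq> \<phi> ` carrier (free_plus_Z2 l r)"
      proof
        fix C assume "C \<in> carrier (homology \<Delta> j)"
        then obtain z where z: "z \<in> cycles \<Delta> j" "C = homology_class \<Delta> j z" by (auto simp: carrier_homology)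
        obtain p q where "C = homology_class \<Delta> j (generator_comb j l r x y p q)"
          using generator_class_exists[OF z(1)] z(2) by metis
        also have "\<dots> = \<phi> (restrict p {..<l}, \<lambda>i\<in>{..<r}. q i mod 2)"
          unfolding \<phi>_def prod.case generator_class_eq_iff by simp
        finally show "C \<in> \<phi> ` carrier (free_plus_Z2 l r)"
          by (rule image_eqI) (auto simp: free_plus_Z2_def carrier_integer_mod_group)
      qed
    qed
  qed
  ultimately have "free_plus_Z2 l r \<cong> homology \<Delta> j" by (auto simp: is_iso_def iso_def)
  moreover have "group (free_plus_Z2 l r)"
    by (simp add: free_plus_Z2_def DirProd_group)
  ultimately show ?thesis using group.iso_sym by blast
qed

text \<open>The elements killed by 2 form a subgroup containing the classes of the
  \<open>y i\<close>. Conversely a class killed by \<open>k > 0\<close> has free coefficients with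
  \<open>k * p i = 0\<close>, so only the \<open>y i\<close> are left in it.\<close>

lemma generate_torsion_generators:
  "generate (homology \<Delta> j) ((\<lambda>i. homology_class \<Delta> j (y i)) ` {..<r}) = torsion_part (homology \<Delta> j)"
    (is "generate ?H ?S = _")
proof
  interpret H: comm_group ?H by (rule comm_group_homology)
  have y: "y i \<in> cycles \<Delta> j" "(\<lambda>\<tau>\<in>faces \<Delta> j. 2 * y i \<tau>) \<in> boundaries \<Delta> j" if "i < r" for i
    using basis that by (auto simp: free_plus_Z2_basis_def)
  have S: "C \<in> carrier ?H \<and> C [^]\<^bsub>?H\<^esub> (2::nat) = \<one>\<^bsub>?H\<^esub>" if C: "C \<in> ?S" for C
  proof -
    obtain i where i: "i < r" "C = homology_class \<Delta> j (y i)" using C by auto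
    have "homology_class \<Delta> j (\<lambda>\<tau>\<in>faces \<Delta> j. 2 * y i \<tau>) = boundaries \<Delta> j"
      using homology_class_eq_boundaries_iff[OF cycles_mult[OF y(1)[OF i(1)]]] y(2)[OF i(1)] by blast
    then show ?thesis using i y by (simp add: carrier_homology homology_class_pow one_homology)
  qed
  have "C \<in> carrier ?H \<and> C [^]\<^bsub>?H\<^esub> (2::nat) = \<one>\<^bsub>?H\<^esub>" if "C \<in> generate ?H ?S" for C
    using that
  proof induction
    case (inv h)
    then show ?case using S[of h] by (simp add: H.nat_pow_inv)
  next
    case (eng h1 h2)
    then show ?case by (simp add: H.nat_pow_distrib)
  qed (use S in auto)
  then show "generate ?H ?S \<subseteq> torsion_part ?H"
    by (auto simp: torsion_part_def intro!: exI[of _ "2::nat"])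
  \<comment> \<open>Summands are added one at a time, and only the parity of \<open>q t\<close>
    matters: an even multiple of \<open>y t\<close> bounds, an odd one is homologous to
    \<open>y t\<close>.\<close>
  have gen: "homology_class \<Delta> j (\<lambda>\<tau>\<in>faces \<Delta> j. \<Sum>i<t. q i * y i \<tau>) \<in> generate ?H ?S" if "t \<le> r" for t q
    using that
  proof (induction t)
    case 0
    have "homology_class \<Delta> j (\<lambda>\<tau>\<in>faces \<Delta> j. 0) = \<one>\<^bsub>?H\<^esub>"
      using boundaries_zero boundaries_subset_cycles
      by (simp add: one_homology homology_class_eq_boundaries_iff subset_iff)
    then show ?case using generate.one[of ?H ?S] by (simp add: restrict_def)
  next
    case (Suc t)
    have ct: "(\<lambda>\<tau>\<in>faces \<Delta> j. \<Sum>i<t. q i * y i \<tau>) \<in> cycles \<Delta> j"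
      using Suc y by (intro cycles_lincomb) auto
    have "homology_class \<Delta> j (\<lambda>\<tau>\<in>faces \<Delta> j. q t * y t \<tau>) \<in> generate ?H ?S"
    proof (cases "even (q t)")
      case True
      have "(\<lambda>\<tau>\<in>faces \<Delta> j. q t * y t \<tau>) \<in> boundaries \<Delta> j"
        using boundaries_mult[OF y(2)[of t], of "q t div 2"] Suc True
        by (simp add: mult.assoc[symmetric] cong: restrict_cong)
      then have "homology_class \<Delta> j (\<lambda>\<tau>\<in>faces \<Delta> j. q t * y t \<tau>) = \<one>\<^bsub>?H\<^esub>"
        using boundaries_subset_cycles by (simp add: one_homology homology_class_eq_boundaries_iff subset_iff)
      then show ?thesis by (simp add: generate.one)
    next
      case False
      have "(\<lambda>\<tau>\<in>faces \<Delta> j. (q t - 1) * y t \<tau>) \<in> boundaries \<Delta> j"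
        using boundaries_mult[OF y(2)[of t], of "(q t - 1) div 2"] Suc False
        by (simp add: mult.assoc[symmetric] cong: restrict_cong)
      then have "homology_class \<Delta> j (\<lambda>\<tau>\<in>faces \<Delta> j. q t * y t \<tau>) = homology_class \<Delta> j (y t)"
        using y Suc by (subst homology_class_eq_iff) (auto simp: cycles_mult algebra_simps cong: restrict_cong)
      then show ?thesis using Suc by (auto intro: generate.incl)
    qed
    moreover have "homology_class \<Delta> j (\<lambda>\<tau>\<in>faces \<Delta> j. \<Sum>i<Suc t. q i * y i \<tau>) =
        homology_class \<Delta> j (\<lambda>\<tau>\<in>faces \<Delta> j. \<Sum>i<t. q i * y i \<tau>) \<otimes>\<^bsub>?H\<^esub> homology_class \<Delta> j (\<lambda>\<tau>\<in>faces \<Delta> j. q t * y t \<tau>)"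
      using Suc y ct by (subst homology_class_add) (auto simp: cycles_mult cong: restrict_cong)
    ultimately show ?case using Suc by (simp add: restrict_def generate.eng)
  qed
  show "torsion_part ?H \<subseteq> generate ?H ?S"
  proof
    fix C assume "C \<in> torsion_part ?H"
    then obtain k :: nat where C: "C \<in> carrier ?H" "k > 0" "C [^]\<^bsub>?H\<^esub> k = \<one>\<^bsub>?H\<^esub>" by (auto simp: torsion_part_def)
    then obtain z where z: "z \<in> cycles \<Delta> j" "C = homology_class \<Delta> j z" by (auto simp: carrier_homology)
    obtain p q where pq: "C = homology_class \<Delta> j (generator_comb j l r x y p q)"
      using generator_class_exists[OF z(1)] z(2) by metis
    have "(\<lambda>\<tau>\<in>faces \<Delta> j. int k * generator_comb j l r x y p q \<tau>)
        = generator_comb j l r x y (\<lambda>i. int k * p i) (\<lambda>i. int k * q i)"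
      by (auto simp: generator_comb_def fun_eq_iff algebra_simps sum_distrib_left)
    then have "generator_comb j l r x y (\<lambda>i. int k * p i) (\<lambda>i. int k * q i) \<in> boundaries \<Delta> j"
      using C(3) generator_comb_cycle
      by (simp add: pq homology_class_pow one_homology homology_class_eq_boundaries_iff cycles_mult)
    then have "\<forall>i<l. int k * p i = 0" using basis unfolding free_plus_Z2_basis_def by blast
    then have "generator_comb j l r x y p q = (\<lambda>\<tau>\<in>faces \<Delta> j. \<Sum>i<r. q i * y i \<tau>)"
      using C(2) by (simp add: generator_comb_def)
    then show "C \<in> generate ?H ?S" using pq gen[of r q] by simp
  qed
qed

end

end

section \<open>Complexes without top homology\<close>

lemma common_denominator:
  fixes f :: "'b \<Rightarrow> real"
  assumes "finite A" "\<forall>x\<in>A. f x \<in> \<rat>"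
  shows "\<exists>k::nat. k > 0 \<and> (\<forall>x\<in>A. real k * f x \<in> \<int>)"
  using assms
proof (induction A rule: finite_induct)
  case empty
  then show ?case by (intro exI[of _ 1]) simp
next
  case (insert x A)
  then obtain k :: nat where k: "k > 0" "\<forall>y\<in>A. real k * f y \<in> \<int>" by auto
  obtain p q :: int where q: "q > 0" "f x = of_int p / of_int q"
    using insert.prems Rats_cases'[of "f x"] by (metis insertI1)
  have "real (k * nat q) * f y \<in> \<int>" if "y \<in> insert x A" for y
  proof (cases "y = x")
    case True
    then have "real (k * nat q) * f y = of_int (int k * p)" using q by simp
    then show ?thesis by (simp only: Ints_of_int)
  next
    case False
    then have "real k * f y \<in> \<int>" using that k(2) by auto
    from Ints_mult[OF Ints_of_int[of q] this]
    have "of_int q * (real k * f y) \<in> \<int>" .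
    then show ?thesis using q(1) by (simp add: algebra_simps)
  qed
  then show ?case using k(1) q(1) by (intro exI[of _ "k * nat q"]) simp
qed

locale top_acyclic_complex = simplicial_complex n \<Delta> for n \<Delta> +
  fixes d :: nat and \<rho> :: "'m::finite \<Rightarrow> nat set"
  assumes dim_pos: "1 \<le> d"
    and dim: "complex_dim \<Delta> = int d"
    and acyclic: "trivial_group (homology \<Delta> d)"
    and rows: "bij_betw \<rho> UNIV (faces \<Delta> (d - 1))"
begin

text \<open>Keeps the simplifier from turning \<open>d - 1\<close> into \<open>d - Suc 0\<close>, so
  that goals continue to match facts stated for \<open>d - 1\<close>.\<close>

declare One_nat_def [simp del]

abbreviation "D \<equiv> faces \<Delta> d"
abbreviation "E \<equiv> faces \<Delta> (d - 1)"
abbreviation "H \<equiv> homology \<Delta> (d - 1)"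

section \<open>Chains and boundary columns as vectors\<close>

definition chain_vec :: "(nat set \<Rightarrow> int) \<Rightarrow> real ^ 'm" where
  "chain_vec c = (\<chi> i. of_int (c (\<rho> i)))"

text \<open>This is \<open>\<partial>\<^sub>d v\<close> in coordinates:
  \<open>chain_vec z = column_comb v\<close> is the way to say that the integral chain
  \<open>z\<close> is the boundary of the real chain \<open>v\<close>.\<close>

definition column_comb :: "(nat set \<Rightarrow> real) \<Rightarrow> real ^ 'm" where
  "column_comb v = (\<Sum>\<sigma>\<in>D. v \<sigma> *\<^sub>R boundary_column \<rho> \<sigma>)"

lemma row_face: "\<rho> i \<in> E"
  using rows by (auto simp: bij_betw_def)

lemma row_exists: "\<tau> \<in> E \<Longrightarrow> \<exists>i. \<rho> i = \<tau>"
  using rows by (metis bij_betw_imp_surj_on imageE)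

lemma Max_card: "Max (card ` \<Delta>) = d + 1"
  using dim by (simp add: complex_dim_def)

lemma facets_nonempty: "D \<noteq> {}"
proof -
  have "{} \<in> \<Delta>" using complex by (simp add: abstract_simplicial_complex_def)
  then have "Max (card ` \<Delta>) \<in> card ` \<Delta>" using finite_complex by (intro Max_in) auto
  then show ?thesis unfolding Max_card by (auto simp: faces_def)
qed

lemma no_higher_faces: "faces \<Delta> (d + 1) = {}"
proof -
  have "card \<sigma> \<le> d + 1" if "\<sigma> \<in> \<Delta>" for \<sigma>
    using Max_ge[of "card ` \<Delta>" "card \<sigma>"] finite_complex that by (simp add: Max_card)
  then show ?thesis by (fastforce simp: faces_def)
qed

text \<open>An integral relation between the columns is a \<open>d\<close>-cycle, hence a boundary
  by acyclicity, hence zero since there are no faces of dimension \<open>d + 1\<close>.\<close>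

lemma integer_kernel_trivial:
  fixes p :: "nat set \<Rightarrow> int"
  assumes "\<And>\<tau>. \<tau> \<in> E \<Longrightarrow> (\<Sum>\<sigma>\<in>D. incidence \<tau> \<sigma> * p \<sigma>) = 0"
  shows "\<forall>\<sigma>\<in>D. p \<sigma> = 0"
proof -
  have cyc: "restrict p D \<in> cycles \<Delta> d"
    unfolding cycles_iff using assms by simp
  then have "homology_class \<Delta> d (restrict p D) \<in> carrier (homology \<Delta> d)"
    by (simp add: carrier_homology)
  then have "homology_class \<Delta> d (restrict p D) = boundaries \<Delta> d"
    using acyclic by (simp add: trivial_group_def one_homology)
  then have "restrict p D \<in> boundaries \<Delta> d" using homology_class_eq_boundaries_iff[OF cyc] by simp
  then obtain c where "restrict p D = boundary \<Delta> (d + 1) c" by (auto simp: boundaries_eq_range)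
  then have e: "restrict p D \<sigma> = boundary \<Delta> (d + 1) c \<sigma>" for \<sigma> by simp
  show ?thesis
  proof
    fix \<sigma> assume "\<sigma> \<in> D"
    then show "p \<sigma> = 0" using e[of \<sigma>] no_higher_faces by (simp add: boundary_def)
  qed
qed

lemma column_comb_nth: "column_comb v $ i = (\<Sum>\<sigma>\<in>D. of_int (incidence (\<rho> i) \<sigma>) * v \<sigma>)"
  by (simp add: column_comb_def boundary_column_def mult.commute)

lemma column_comb_eq_0D:
  assumes "column_comb v = 0" "\<sigma> \<in> D"
  shows "v \<sigma> = 0"
proof (rule integer_kernel_imp_real_kernel[where A = incidence and E = E])
  fix \<tau> assume "\<tau> \<in> E"
  then obtain i where "\<rho> i = \<tau>" using row_exists by blast
  then show "(\<Sum>\<sigma>\<in>D. of_int (incidence \<tau> \<sigma>) * v \<sigma>) = 0"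
    using column_comb_nth[of v i] assms(1) by simp
qed (use integer_kernel_trivial finite_faces assms(2) in auto)

lemma column_comb_diff: "column_comb v - column_comb w = column_comb (\<lambda>\<sigma>. v \<sigma> - w \<sigma>)"
  by (simp add: column_comb_def scaleR_left_diff_distrib sum_subtractf)

lemma column_comb_add: "column_comb v + column_comb w = column_comb (\<lambda>\<sigma>. v \<sigma> + w \<sigma>)"
  by (simp add: column_comb_def scaleR_left_distrib sum.distrib)

lemma column_comb_scale: "k *\<^sub>R column_comb v = column_comb (\<lambda>\<sigma>. k * v \<sigma>)"
  by (simp add: column_comb_def scaleR_sum_right)

lemma column_comb_eqD:
  assumes "column_comb v = column_comb w" "\<sigma> \<in> D"
  shows "v \<sigma> = w \<sigma>"
  using column_comb_eq_0D[of "\<lambda>\<sigma>. v \<sigma> - w \<sigma>" \<sigma>] assms by (simp flip: column_comb_diff)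

lemma chain_vec_boundary: "chain_vec (boundary \<Delta> d c) = column_comb (\<lambda>\<sigma>. of_int (c \<sigma>))"
  using row_face by (simp add: vec_eq_iff column_comb_nth chain_vec_def boundary_def)

lemma chain_vec_add: "chain_vec (\<lambda>\<tau>\<in>E. x \<tau> + y \<tau>) = chain_vec x + chain_vec y"
  using row_face by (simp add: vec_eq_iff chain_vec_def)

lemma chain_vec_diff: "chain_vec (\<lambda>\<tau>\<in>E. x \<tau> - y \<tau>) = chain_vec x - chain_vec y"
  using row_face by (simp add: vec_eq_iff chain_vec_def)

lemma chain_vec_mult: "chain_vec (\<lambda>\<tau>\<in>E. k * x \<tau>) = of_int k *\<^sub>R chain_vec x"
  using row_face by (simp add: vec_eq_iff chain_vec_def)

lemma integral_chain_vec: "integral_vector (chain_vec c)"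
  by (simp add: integral_vector_def chain_vec_def)

lemma chain_vec_inj: "inj_on chain_vec (E \<rightarrow>\<^sub>E UNIV)"
proof (rule inj_onI)
  fix x y assume xy: "x \<in> E \<rightarrow>\<^sub>E UNIV" "y \<in> E \<rightarrow>\<^sub>E UNIV" "chain_vec x = chain_vec y"
  show "x = y"
  proof (rule PiE_ext[OF xy(1,2)])
    fix \<tau> assume "\<tau> \<in> E"
    then obtain i where "\<rho> i = \<tau>" using row_exists by blast
    then show "x \<tau> = y \<tau>" using xy(3) by (auto simp: chain_vec_def vec_eq_iff)
  qed
qed

lemma boundaries_E: "boundaries \<Delta> (d - 1) = range (boundary \<Delta> d)"
  using boundaries_eq_range[of "d - 1"] dim_pos by simp

lemma boundaries_chain_vec_iff:
  assumes "z \<in> E \<rightarrow>\<^sub>E UNIV"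
  shows "z \<in> boundaries \<Delta> (d - 1) \<longleftrightarrow> (\<exists>c :: nat set \<Rightarrow> int. chain_vec z = column_comb (\<lambda>\<sigma>. of_int (c \<sigma>)))"
proof
  assume "z \<in> boundaries \<Delta> (d - 1)"
  then obtain c where "z = boundary \<Delta> d c" by (auto simp: boundaries_E)
  then show "\<exists>c :: nat set \<Rightarrow> int. chain_vec z = column_comb (\<lambda>\<sigma>. of_int (c \<sigma>))"
    using chain_vec_boundary[of c] by blast
next
  assume "\<exists>c :: nat set \<Rightarrow> int. chain_vec z = column_comb (\<lambda>\<sigma>. of_int (c \<sigma>))"
  then obtain c :: "nat set \<Rightarrow> int" where "chain_vec z = chain_vec (boundary \<Delta> d c)"
    using chain_vec_boundary by metis
  then have "z = boundary \<Delta> d c"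
    by (rule inj_onD[OF chain_vec_inj]) (use assms in \<open>auto simp: boundary_def\<close>)
  then show "z \<in> boundaries \<Delta> (d - 1)" by (simp add: boundaries_E)
qed

text \<open>If \<open>k z\<close> is the boundary of an integral chain \<open>c\<close>,
  independence of the columns forces \<open>k v = c\<close> on \<open>D\<close>.\<close>

lemma boundary_multiple_imp_integral:
  assumes "z \<in> E \<rightarrow>\<^sub>E UNIV" "chain_vec z = column_comb v" "(\<lambda>\<tau>\<in>E. k * z \<tau>) \<in> boundaries \<Delta> (d - 1)" "\<sigma> \<in> D"
  shows "of_int k * v \<sigma> \<in> \<int>"
proof -
  have "(\<lambda>\<tau>\<in>E. k * z \<tau>) \<in> E \<rightarrow>\<^sub>E UNIV" by simp
  then obtain c :: "nat set \<Rightarrow> int" where "chain_vec (\<lambda>\<tau>\<in>E. k * z \<tau>) = column_comb (\<lambda>\<sigma>. of_int (c \<sigma>))"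
    using boundaries_chain_vec_iff assms(3) by blast
  then have "column_comb (\<lambda>\<sigma>. of_int k * v \<sigma>) = column_comb (\<lambda>\<sigma>. of_int (c \<sigma>))"
    by (simp add: chain_vec_mult assms(2) column_comb_scale)
  from column_comb_eqD[OF this assms(4)] show ?thesis by simp
qed

lemma reflexive_iff_signs:
  "reflexive (symmetric_homology_polytope \<rho> \<Delta> :: (real ^ 'm) set) \<longleftrightarrow>
    (\<forall>\<epsilon>. (\<forall>\<sigma>\<in>D. \<epsilon> \<sigma> \<in> {1, -1}) \<longrightarrow>
      (\<exists>w. integral_vector w \<and> (\<forall>\<sigma>\<in>D. w \<bullet> (boundary_column \<rho> \<sigma> :: real ^ 'm) = \<epsilon> \<sigma>)))"
proof -
  let ?a = "boundary_column \<rho> :: nat set \<Rightarrow> real ^ 'm"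
  have inj: "inj_on ?a D"
  proof (rule inj_onI, rule ccontr)
    fix \<sigma> \<sigma>' assume s: "\<sigma> \<in> D" "\<sigma>' \<in> D" "?a \<sigma> = ?a \<sigma>'" "\<sigma> \<noteq> \<sigma>'"
    have single: "column_comb (\<lambda>\<tau>. if \<tau> = \<sigma> then 1 else 0) = ?a \<sigma>" if "\<sigma> \<in> D" for \<sigma>
      using that finite_faces by (simp add: column_comb_def if_distrib[of "\<lambda>c. c *\<^sub>R _"] cong: if_cong)
    have "column_comb (\<lambda>\<tau>. if \<tau> = \<sigma> then 1 else 0) = column_comb (\<lambda>\<tau>. if \<tau> = \<sigma>' then 1 else 0)"
      using s single by simp
    from column_comb_eqD[OF this s(1)] show False using s(4) by simp
  qed
  have ind: "independent (?a ` D)"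
  proof (rule independent_if_scalars_zero)
    show "finite (?a ` D)" using finite_faces by simp
    fix f x assume f: "(\<Sum>x\<in>?a ` D. f x *\<^sub>R x) = 0" and x: "x \<in> ?a ` D"
    then have "column_comb (\<lambda>\<sigma>. f (?a \<sigma>)) = 0"
      by (simp add: column_comb_def sum.reindex[OF inj])
    then show "f x = 0" using column_comb_eq_0D x by auto
  qed
  have "nat (complex_dim \<Delta>) = d" by (simp add: dim)
  then have "symmetric_homology_polytope \<rho> \<Delta> = convex hull (?a ` D \<union> uminus ` ?a ` D)"
    by (simp add: symmetric_homology_polytope_def Let_def)
  then show ?thesis
    using reflexive_crosspolytope_iff[OF finite_faces facets_nonempty inj ind]
    by (simp add: integral_vector_def boundary_column_def)
qed

section \<open>Reflexivity, the dual lattice and torsion classes\<close>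

lemma reflexive_imp_half_integral:
  assumes "reflexive (symmetric_homology_polytope \<rho> \<Delta> :: (real ^ 'm) set)" "integral_vector (column_comb v)"
  shows "(\<Sum>\<sigma>\<in>D. v \<sigma>) \<in> \<int>" and "\<sigma> \<in> D \<Longrightarrow> 2 * v \<sigma> \<in> \<int>"
  using sign_vectors_imp_half_integral[OF finite_faces, where a = "boundary_column \<rho>" and v = v] assms
  unfolding reflexive_iff_signs column_comb_def by blast+

lemma half_integral_imp_reflexive:
  assumes "\<And>v. \<forall>\<sigma>\<in>D. v \<sigma> \<in> \<rat> \<Longrightarrow> integral_vector (column_comb v)
      \<Longrightarrow> (\<forall>\<sigma>\<in>D. 2 * v \<sigma> \<in> \<int>) \<and> (\<Sum>\<sigma>\<in>D. v \<sigma>) \<in> \<int>"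
  shows "reflexive (symmetric_homology_polytope \<rho> \<Delta> :: (real ^ 'm) set)"
  unfolding reflexive_iff_signs
  using half_integral_imp_sign_vectors[OF finite_faces, where a = "boundary_column \<rho> :: nat set \<Rightarrow> real ^ 'm"] assms
  by (simp add: column_comb_def integral_vector_def boundary_column_def)

text \<open>A common denominator \<open>k\<close> of \<open>v\<close> makes \<open>k z\<close> a
  boundary, so \<open>k\<close> kills the class. That \<open>z\<close> is a cycle follows from the
  same multiple by saturation, without computing \<open>\<partial>\<partial>\<close> over the
  reals.\<close>

lemma torsion_class_of_rational:
  assumes "\<forall>\<sigma>\<in>D. v \<sigma> \<in> \<rat>" "integral_vector (column_comb v)"
  obtains z where "z \<in> cycles \<Delta> (d - 1)" "chain_vec z = column_comb v"
    "homology_class \<Delta> (d - 1) z \<in> torsion_part H"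
proof -
  \<comment> \<open>The floors are exact; they only turn integral real coordinates into
    integers.\<close>
  define z where "z = (\<lambda>\<tau>\<in>E. \<lfloor>column_comb v $ (inv_into UNIV \<rho> \<tau>)\<rfloor>)"
  have inj: "inj \<rho>" using rows by (simp add: bij_betw_def)
  have vec: "chain_vec z = column_comb v"
    using assms(2) row_face inj by (simp add: vec_eq_iff chain_vec_def z_def integral_vector_def)
  obtain k :: nat where k: "k > 0" "\<forall>\<sigma>\<in>D. real k * v \<sigma> \<in> \<int>"
    using common_denominator[OF finite_faces assms(1)] by blast
  have "chain_vec (\<lambda>\<tau>\<in>E. int k * z \<tau>) = column_comb (\<lambda>\<sigma>. of_int \<lfloor>real k * v \<sigma>\<rfloor>)"
    unfolding chain_vec_mult vec column_comb_scale using k(2) by (auto simp: column_comb_def intro!: sum.cong)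
  then have kz: "(\<lambda>\<tau>\<in>E. int k * z \<tau>) \<in> boundaries \<Delta> (d - 1)"
    using boundaries_chain_vec_iff[of "\<lambda>\<tau>\<in>E. int k * z \<tau>"] by auto
  have z: "z \<in> cycles \<Delta> (d - 1)"
  proof (rule cycles_saturated)
    show "z \<in> E \<rightarrow>\<^sub>E UNIV" by (simp add: z_def)
    show "int k \<noteq> 0" using k by simp
    show "(\<lambda>\<tau>\<in>E. int k * z \<tau>) \<in> cycles \<Delta> (d - 1)" using kz boundaries_subset_cycles by blast
  qed
  have "homology_class \<Delta> (d - 1) z [^]\<^bsub>H\<^esub> k = \<one>\<^bsub>H\<^esub>"
    unfolding homology_class_pow[OF z] one_homology homology_class_eq_boundaries_iff[OF cycles_mult[OF z]]
    by (rule kz)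
  then show thesis using that[OF z vec] z k by (auto simp: torsion_part_def carrier_homology)
qed

lemma half_integral_of_torsion_exponent:
  assumes "z \<in> cycles \<Delta> (d - 1)" "chain_vec z = column_comb v"
    "homology_class \<Delta> (d - 1) z [^]\<^bsub>H\<^esub> (2::nat) = \<one>\<^bsub>H\<^esub>" "\<sigma> \<in> D"
  shows "2 * v \<sigma> \<in> \<int>"
proof -
  have "(\<lambda>\<tau>\<in>E. 2 * z \<tau>) \<in> boundaries \<Delta> (d - 1)"
    using assms(3) homology_class_eq_boundaries_iff[OF cycles_mult[OF assms(1)], of 2]
    by (simp add: homology_class_pow[OF assms(1)] one_homology)
  from boundary_multiple_imp_integral[OF cycles_extensional[OF assms(1)] assms(2) this assms(4)]
  show ?thesis by simp
qed

text \<open>Adding up all coordinates of \<open>\<partial>\<^sub>d v\<close> weights each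
  \<open>v \<sigma>\<close> by its column sum, which is 1 for even \<open>d\<close>.\<close>

lemma sum_integral_of_even_dim:
  assumes "even d" "integral_vector (column_comb v)"
  shows "(\<Sum>\<sigma>\<in>D. v \<sigma>) \<in> \<int>"
proof -
  have col: "(\<Sum>i\<in>UNIV. incidence (\<rho> i) \<sigma>) = 1" if "\<sigma> \<in> D" for \<sigma>
  proof -
    have "(\<Sum>i\<in>UNIV. incidence (\<rho> i) \<sigma>) = (\<Sum>\<tau>\<in>E. incidence \<tau> \<sigma>)"
      by (rule sum.reindex_bij_betw[OF rows])
    also have "\<dots> = 1"
    proof (rule sum_incidence_even[OF finite_face[OF that] finite_faces])
      show "\<sigma> - {x} \<in> E" if "x \<in> \<sigma>" for x
        using face_Diff_singleton[of \<sigma> "d - 1" x] that \<open>\<sigma> \<in> D\<close> dim_pos by simp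
      show "card \<sigma> = d + 1" using that by (simp add: faces_def)
    qed (rule assms(1))
    finally show ?thesis .
  qed
  have "(\<Sum>\<sigma>\<in>D. v \<sigma>) = (\<Sum>\<sigma>\<in>D. of_int (\<Sum>i\<in>UNIV. incidence (\<rho> i) \<sigma>) * v \<sigma>)"
    using col by simp
  also have "\<dots> = (\<Sum>i\<in>UNIV. column_comb v $ i)"
    unfolding column_comb_nth of_int_sum sum_distrib_right by (rule sum.swap)
  also have "\<dots> \<in> \<int>" using assms(2) by (intro Ints_sum) (simp add: integral_vector_def)
  finally show ?thesis .
qed

section \<open>From homology to reflexivity\<close>

text \<open>Read through the isomorphism: the free coordinates of a torsion element vanish, and
  doubling kills the coordinates modulo 2.\<close>

lemma free_plus_Z2_torsion_exponent:
  assumes "H \<cong> free_plus_Z2 l r" "C \<in> torsion_part H"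
  shows "C [^]\<^bsub>H\<^esub> (2::nat) = \<one>\<^bsub>H\<^esub>"
proof -
  let ?F = "free_plus_Z2 l r"
  have F: "group ?F" by (simp add: free_plus_Z2_def DirProd_group)
  obtain h where h: "h \<in> hom H ?F" "bij_betw h (carrier H) (carrier ?F)"
    using assms(1) by (auto simp: is_iso_def iso_def)
  interpret h: group_hom H ?F h
    using group_homology F h(1) by (simp add: group_hom_def group_hom_axioms_def)
  have pow: "(p, q) [^]\<^bsub>?F\<^esub> (k::nat) = (\<lambda>i\<in>{..<l}. int k * p i, \<lambda>i\<in>{..<r}. (int k * q i) mod 2)" for p q k
    by (induction k) (auto simp: free_plus_Z2_def algebra_simps mod_simps cong: restrict_cong)
  have one: "\<one>\<^bsub>?F\<^esub> = (\<lambda>i\<in>{..<l}. 0, \<lambda>i\<in>{..<r}. 0)" by (simp add: free_plus_Z2_def)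
  obtain k :: nat where C: "C \<in> carrier H" "k > 0" "C [^]\<^bsub>H\<^esub> k = \<one>\<^bsub>H\<^esub>" using assms(2) by (auto simp: torsion_part_def)
  obtain p q where pq: "h C = (p, q)" by (cases "h C")
  have "h C [^]\<^bsub>?F\<^esub> k = \<one>\<^bsub>?F\<^esub>" using C by (metis h.hom_nat_pow h.hom_one)
  then have "(\<lambda>i\<in>{..<l}. int k * p i) = (\<lambda>i\<in>{..<l}. 0)" unfolding pq pow one by simp
  then have "int k * p i = 0" if "i < l" for i using that by (metis lessThan_iff restrict_apply')
  then have p: "p i = 0" if "i < l" for i using that C(2) by simp
  have "h C [^]\<^bsub>?F\<^esub> (2::nat) = \<one>\<^bsub>?F\<^esub>"
    unfolding pq pow one using p by (simp cong: restrict_cong)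
  then have "h (C [^]\<^bsub>H\<^esub> (2::nat)) = h \<one>\<^bsub>H\<^esub>" using C by (metis h.hom_nat_pow h.hom_one)
  then show ?thesis using h(2) C(1) by (intro inj_onD[of h "carrier H"]) (auto simp: bij_betw_def)
qed

text \<open>The class of \<open>\<partial>\<^sub>d v\<close> is trivial, so \<open>v\<close> itself
  is already integral.\<close>

lemma trivial_homology_imp_reflexive:
  assumes "trivial_group H"
  shows "reflexive (symmetric_homology_polytope \<rho> \<Delta> :: (real ^ 'm) set)"
proof (rule half_integral_imp_reflexive)
  fix v :: "nat set \<Rightarrow> real" assume v: "\<forall>\<sigma>\<in>D. v \<sigma> \<in> \<rat>" "integral_vector (column_comb v)"
  obtain z where z: "z \<in> cycles \<Delta> (d - 1)" "chain_vec z = column_comb v" "homology_class \<Delta> (d - 1) z \<in> torsion_part H"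
    using torsion_class_of_rational[OF v] .
  then have "homology_class \<Delta> (d - 1) z \<in> carrier H" by (simp add: torsion_part_def)
  then have "homology_class \<Delta> (d - 1) z = boundaries \<Delta> (d - 1)"
    using assms by (simp add: trivial_group_def one_homology)
  then have "z \<in> boundaries \<Delta> (d - 1)" using homology_class_eq_boundaries_iff[OF z(1)] by simp
  then have "(\<lambda>\<tau>\<in>E. 1 * z \<tau>) \<in> boundaries \<Delta> (d - 1)" by (rule boundaries_mult)
  then have "v \<sigma> \<in> \<int>" if "\<sigma> \<in> D" for \<sigma>
    using boundary_multiple_imp_integral[OF cycles_extensional[OF z(1)] z(2) _ that, of 1] by simp
  then show "(\<forall>\<sigma>\<in>D. 2 * v \<sigma> \<in> \<int>) \<and> (\<Sum>\<sigma>\<in>D. v \<sigma>) \<in> \<int>" by (auto intro!: Ints_sum Ints_mult)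
qed

lemma even_dim_imp_reflexive:
  assumes "even d" "H \<cong> free_plus_Z2 l r"
  shows "reflexive (symmetric_homology_polytope \<rho> \<Delta> :: (real ^ 'm) set)"
proof (rule half_integral_imp_reflexive)
  fix v :: "nat set \<Rightarrow> real" assume v: "\<forall>\<sigma>\<in>D. v \<sigma> \<in> \<rat>" "integral_vector (column_comb v)"
  obtain z where z: "z \<in> cycles \<Delta> (d - 1)" "chain_vec z = column_comb v" "homology_class \<Delta> (d - 1) z \<in> torsion_part H"
    using torsion_class_of_rational[OF v] .
  then show "(\<forall>\<sigma>\<in>D. 2 * v \<sigma> \<in> \<int>) \<and> (\<Sum>\<sigma>\<in>D. v \<sigma>) \<in> \<int>"
    using half_integral_of_torsion_exponent[OF z(1,2) free_plus_Z2_torsion_exponent[OF assms(2) z(3)]]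
      sum_integral_of_even_dim[OF assms(1) v(2)] by blast
qed

lemma boundary_chain_vec:
  assumes "\<forall>\<tau>\<in>E. boundary \<Delta> d v \<tau> = real_of_int (z \<tau>)"
  shows "chain_vec z = column_comb v"
  using assms row_face by (simp add: vec_eq_iff chain_vec_def column_comb_nth boundary_def)

lemma homology_class_inv:
  assumes "z \<in> cycles \<Delta> (d - 1)"
  shows "inv\<^bsub>H\<^esub> (homology_class \<Delta> (d - 1) z) = homology_class \<Delta> (d - 1) (\<lambda>\<tau>\<in>E. - 1 * z \<tau>)"
proof (rule group.inv_equality[OF group_homology])
  have z': "(\<lambda>\<tau>\<in>E. - 1 * z \<tau>) \<in> cycles \<Delta> (d - 1)" by (rule cycles_mult[OF assms])
  have "homology_class \<Delta> (d - 1) (\<lambda>\<tau>\<in>E. 0) = boundaries \<Delta> (d - 1)"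
    using boundaries_zero[of "d - 1"] boundaries_subset_cycles[of "d - 1"] homology_class_eq_boundaries_iff by blast
  then show "homology_class \<Delta> (d - 1) (\<lambda>\<tau>\<in>E. - 1 * z \<tau>) \<otimes>\<^bsub>H\<^esub> homology_class \<Delta> (d - 1) z = \<one>\<^bsub>H\<^esub>"
    unfolding homology_class_add[OF z' assms] one_homology by (simp cong: restrict_cong)
  show "homology_class \<Delta> (d - 1) z \<in> carrier H" "homology_class \<Delta> (d - 1) (\<lambda>\<tau>\<in>E. - 1 * z \<tau>) \<in> carrier H"
    using assms z' by (auto simp: carrier_homology)
qed

text \<open>Integrality of the coordinate sum propagates from the generators to some preimage of
  every torsion class. Any other vector of the dual lattice with the same class differs from that
  preimage by integers, so its sum is integral too.\<close>

lemma torsion_generators_imp_reflexive: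
  fixes v :: "nat \<Rightarrow> nat set \<Rightarrow> real"
  assumes iso: "H \<cong> free_plus_Z2 l r"
    and z: "\<And>i. i < r \<Longrightarrow> z i \<in> E \<rightarrow>\<^sub>E UNIV"
    and vz: "\<And>i. i < r \<Longrightarrow> chain_vec (z i) = column_comb (v i)"
    and sum: "\<And>i. i < r \<Longrightarrow> (\<Sum>\<sigma>\<in>D. v i \<sigma>) \<in> \<int>"
    and gen: "generate H ((\<lambda>i. homology_class \<Delta> (d - 1) (z i)) ` {..<r}) = torsion_part H"
  shows "reflexive (symmetric_homology_polytope \<rho> \<Delta> :: (real ^ 'm) set)"
proof -
  let ?h = "homology_class \<Delta> (d - 1)"
  let ?S = "(\<lambda>i. ?h (z i)) ` {..<r}"
  \<comment> \<open>The \<open>z i\<close> are only known as chains. The class of \<open>z i\<close>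
    is a torsion element, hence also the class of a cycle \<open>w\<close>, and \<open>z i\<close>
    differs from \<open>w\<close> by a boundary.\<close>
  have zc: "z i \<in> cycles \<Delta> (d - 1)" if i: "i < r" for i
  proof -
    have "?h (z i) \<in> torsion_part H" using gen i by (metis generate.incl imageI lessThan_iff)
    then have "?h (z i) \<in> carrier H" by (simp add: torsion_part_def)
    then obtain w where w: "w \<in> cycles \<Delta> (d - 1)" "?h (z i) = ?h w" by (auto simp: carrier_homology)
    then obtain b where b: "b \<in> boundaries \<Delta> (d - 1)" "z i = (\<lambda>\<tau>\<in>E. b \<tau> + w \<tau>)"
      using homology_class_self[OF z[OF i]] mem_homology_class by metis
    show ?thesis
      unfolding b(2) by (rule cycles_add[OF subsetD[OF boundaries_subset_cycles b(1)] w(1)])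
  qed
  have rep: "\<exists>w u. w \<in> cycles \<Delta> (d - 1) \<and> C = ?h w \<and> chain_vec w = column_comb u \<and> (\<Sum>\<sigma>\<in>D. u \<sigma>) \<in> \<int>"
    if "C \<in> generate H ?S" for C
    using that
  proof induction
    case one
    have B: "(\<lambda>\<tau>\<in>E. 0) \<in> boundaries \<Delta> (d - 1)" by (rule boundaries_zero)
    then have c: "(\<lambda>\<tau>\<in>E. 0) \<in> cycles \<Delta> (d - 1)" using boundaries_subset_cycles by blast
    have "chain_vec (\<lambda>\<tau>\<in>E. 0) = column_comb (\<lambda>_. 0)"
      using row_face by (simp add: vec_eq_iff chain_vec_def column_comb_def)
    moreover have "\<one>\<^bsub>H\<^esub> = ?h (\<lambda>\<tau>\<in>E. 0)"
      using homology_class_eq_boundaries_iff[OF c] B by (simp add: one_homology)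
    moreover have "(\<Sum>\<sigma>\<in>D. 0 :: real) \<in> \<int>" by simp
    ultimately show ?case using c by blast
  next
    case (incl C)
    then obtain i where i: "i < r" "C = ?h (z i)" by auto
    show ?case using zc[OF i(1)] vz[OF i(1)] sum[OF i(1)] i(2) by blast
  next
    case (inv C)
    then obtain i where i: "i < r" "C = ?h (z i)" by auto
    have "chain_vec (\<lambda>\<tau>\<in>E. -1 * z i \<tau>) = column_comb (\<lambda>\<sigma>. - v i \<sigma>)"
      unfolding chain_vec_mult vz[OF i(1)] column_comb_scale by simp
    moreover have "(\<Sum>\<sigma>\<in>D. - v i \<sigma>) \<in> \<int>" using sum[OF i(1)] by (simp add: sum_negf)
    ultimately show ?case unfolding i(2) homology_class_inv[OF zc[OF i(1)]]
      using cycles_mult[OF zc[OF i(1)]] by blast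
  next
    case (eng C1 C2)
    then obtain w1 u1 w2 u2 where w: "w1 \<in> cycles \<Delta> (d - 1)" "w2 \<in> cycles \<Delta> (d - 1)" "C1 = ?h w1" "C2 = ?h w2"
      and cv: "chain_vec w1 = column_comb u1" "chain_vec w2 = column_comb u2"
      and s: "(\<Sum>\<sigma>\<in>D. u1 \<sigma>) \<in> \<int>" "(\<Sum>\<sigma>\<in>D. u2 \<sigma>) \<in> \<int>" by blast
    have "chain_vec (\<lambda>\<tau>\<in>E. w1 \<tau> + w2 \<tau>) = column_comb (\<lambda>\<sigma>. u1 \<sigma> + u2 \<sigma>)"
      unfolding chain_vec_add cv column_comb_add ..
    moreover have "(\<Sum>\<sigma>\<in>D. u1 \<sigma> + u2 \<sigma>) \<in> \<int>" using s by (simp add: sum.distrib)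
    ultimately show ?case unfolding w(3,4) homology_class_add[OF w(1,2)] using cycles_add[OF w(1,2)] by blast
  qed
  show ?thesis
  proof (rule half_integral_imp_reflexive)
    fix u :: "nat set \<Rightarrow> real" assume u: "\<forall>\<sigma>\<in>D. u \<sigma> \<in> \<rat>" "integral_vector (column_comb u)"
    obtain w where w: "w \<in> cycles \<Delta> (d - 1)" "chain_vec w = column_comb u" "?h w \<in> torsion_part H"
      using torsion_class_of_rational[OF u] .
    obtain w' u' where w': "w' \<in> cycles \<Delta> (d - 1)" "?h w = ?h w'" "chain_vec w' = column_comb u'" "(\<Sum>\<sigma>\<in>D. u' \<sigma>) \<in> \<int>"
      using rep w(3) gen by blast
    have "(\<lambda>\<tau>\<in>E. w \<tau> - w' \<tau>) \<in> boundaries \<Delta> (d - 1)"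
      using homology_class_eq_iff[OF w(1) w'(1)] w'(2) by simp
    moreover have "(\<lambda>\<tau>\<in>E. w \<tau> - w' \<tau>) \<in> E \<rightarrow>\<^sub>E UNIV" by simp
    ultimately obtain c :: "nat set \<Rightarrow> int"
      where "chain_vec (\<lambda>\<tau>\<in>E. w \<tau> - w' \<tau>) = column_comb (\<lambda>\<sigma>. of_int (c \<sigma>))"
      using boundaries_chain_vec_iff by blast
    then have "column_comb (\<lambda>\<sigma>. u \<sigma> - u' \<sigma>) = column_comb (\<lambda>\<sigma>. of_int (c \<sigma>))"
      by (simp add: chain_vec_diff w(2) w'(3) column_comb_diff)
    then have "u \<sigma> = u' \<sigma> + of_int (c \<sigma>)" if "\<sigma> \<in> D" for \<sigma> using column_comb_eqD that by fastforce
    then have "(\<Sum>\<sigma>\<in>D. u \<sigma>) = (\<Sum>\<sigma>\<in>D. u' \<sigma>) + of_int (\<Sum>\<sigma>\<in>D. c \<sigma>)" by (simp add: sum.distrib)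
    then have "(\<Sum>\<sigma>\<in>D. u \<sigma>) \<in> \<int>" using w'(4) by (metis Ints_add Ints_of_int)
    then show "(\<forall>\<sigma>\<in>D. 2 * u \<sigma> \<in> \<int>) \<and> (\<Sum>\<sigma>\<in>D. u \<sigma>) \<in> \<int>"
      using half_integral_of_torsion_exponent[OF w(1,2) free_plus_Z2_torsion_exponent[OF iso w(3)]] by blast
  qed
qed

section \<open>From reflexivity to homology\<close>

lemma column_comb_cong: "(\<And>\<sigma>. \<sigma> \<in> D \<Longrightarrow> v \<sigma> = w \<sigma>) \<Longrightarrow> column_comb v = column_comb w"
  by (simp add: column_comb_def)

lemma zsubmodule_chain_vec:
  assumes "S \<noteq> {}" "\<And>x y. x \<in> S \<Longrightarrow> y \<in> S \<Longrightarrow> (\<lambda>\<tau>\<in>E. x \<tau> - y \<tau>) \<in> S"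
  shows "zsubmodule (chain_vec ` S)"
  using assms by (auto simp: zsubmodule_def simp flip: chain_vec_diff)

text \<open>Here \<open>z\<close> is the boundary of \<open>c / k\<close>, and reflexivity makes
  twice that vector integral.\<close>

lemma reflexive_imp_double_boundary:
  assumes "reflexive (symmetric_homology_polytope \<rho> \<Delta> :: (real ^ 'm) set)"
    and "z \<in> E \<rightarrow>\<^sub>E UNIV" "k \<noteq> 0" "(\<lambda>\<tau>\<in>E. k * z \<tau>) \<in> boundaries \<Delta> (d - 1)"
  shows "(\<lambda>\<tau>\<in>E. 2 * z \<tau>) \<in> boundaries \<Delta> (d - 1)"
proof -
  have "(\<lambda>\<tau>\<in>E. k * z \<tau>) \<in> E \<rightarrow>\<^sub>E UNIV" by simp
  then obtain c :: "nat set \<Rightarrow> int" where "chain_vec (\<lambda>\<tau>\<in>E. k * z \<tau>) = column_comb (\<lambda>\<sigma>. of_int (c \<sigma>))"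
    using boundaries_chain_vec_iff assms(4) by blast
  then have "(1 / of_int k) *\<^sub>R of_int k *\<^sub>R chain_vec z = column_comb (\<lambda>\<sigma>. (1 / of_int k) * of_int (c \<sigma>))"
    unfolding chain_vec_mult by (simp only: column_comb_scale)
  then have v: "chain_vec z = column_comb (\<lambda>\<sigma>. (1 / of_int k) * of_int (c \<sigma>))" (is "_ = column_comb ?v")
    using assms(3) by simp
  have "integral_vector (column_comb ?v)" unfolding v[symmetric] by (rule integral_chain_vec)
  then have "2 * ?v \<sigma> \<in> \<int>" if "\<sigma> \<in> D" for \<sigma>
    using reflexive_imp_half_integral(2)[OF assms(1) _ that, of ?v] by blast
  then have fl: "of_int \<lfloor>2 * ?v \<sigma>\<rfloor> = 2 * ?v \<sigma>" if "\<sigma> \<in> D" for \<sigma>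
    using that by (intro of_int_floor) blast
  have "chain_vec (\<lambda>\<tau>\<in>E. 2 * z \<tau>) = column_comb (\<lambda>\<sigma>. 2 * ?v \<sigma>)"
    by (simp only: chain_vec_mult v column_comb_scale of_int_numeral)
  also have "\<dots> = column_comb (\<lambda>\<sigma>. of_int \<lfloor>2 * ?v \<sigma>\<rfloor>)"
    by (rule column_comb_cong) (rule fl[symmetric])
  finally have "chain_vec (\<lambda>\<tau>\<in>E. 2 * z \<tau>) = column_comb (\<lambda>\<sigma>. of_int \<lfloor>2 * ?v \<sigma>\<rfloor>)" .
  then show ?thesis using boundaries_chain_vec_iff[of "\<lambda>\<tau>\<in>E. 2 * z \<tau>"] by auto
qed

text \<open>Embedding chains in \<open>real ^ 'm\<close> makes
  \<open>free_plus_Z2_generators\<close> applicable, with the coordinates indexing the generators;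
  bijections with initial segments then turn \<open>U\<close> and \<open>V\<close> into numbered
  families.\<close>

lemma reflexive_imp_basis:
  assumes refl: "reflexive (symmetric_homology_polytope \<rho> \<Delta> :: (real ^ 'm) set)"
  obtains l r x y where "free_plus_Z2_basis (d - 1) l r x y"
proof -
  let ?Z = "chain_vec ` cycles \<Delta> (d - 1)" and ?B = "chain_vec ` boundaries \<Delta> (d - 1)"
  have zero: "(\<lambda>\<tau>\<in>E. 0) \<in> boundaries \<Delta> (d - 1)" by (rule boundaries_zero)
  have Z: "zsubmodule ?Z" using zero boundaries_subset_cycles by (intro zsubmodule_chain_vec cycles_diff) auto
  have B: "zsubmodule ?B" using zero by (intro zsubmodule_chain_vec boundaries_diff) auto
  have BZ: "?B \<subseteq> ?Z" using boundaries_subset_cycles by blast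
  \<comment> \<open>\<open>chain_vec\<close> is injective on extensional chains, so boundaries can
    be recognised by their images.\<close>
  have BD: "w \<in> boundaries \<Delta> (d - 1)" if w: "chain_vec w \<in> ?B" "w \<in> E \<rightarrow>\<^sub>E UNIV" for w
  proof -
    obtain b where b: "b \<in> boundaries \<Delta> (d - 1)" "chain_vec w = chain_vec b" using w(1) by blast
    have "b \<in> E \<rightarrow>\<^sub>E UNIV" using b(1) boundaries_subset_cycles cycles_extensional by blast
    then show ?thesis using inj_onD[OF chain_vec_inj b(2) w(2)] b(1) by simp
  qed
  obtain f :: "'m \<Rightarrow> real ^ 'm" where "generates_mod f UNIV {0} ?Z"
    using integral_zsubmodule_generated[OF finite Z] integral_chain_vec by blast
  then have f: "generates_mod f UNIV ?B ?Z"
    by (rule generates_mod_mono) (use zsubmodule_zero[OF B] in blast)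
  have tors: "2 *\<^sub>R w \<in> ?B" if w: "w \<in> ?Z" "k \<noteq> 0" "of_int k *\<^sub>R w \<in> ?B" for w k
  proof -
    obtain z where z: "z \<in> cycles \<Delta> (d - 1)" "w = chain_vec z" using w(1) by blast
    have "(\<lambda>\<tau>\<in>E. k * z \<tau>) \<in> boundaries \<Delta> (d - 1)"
      by (rule BD) (use w(3) in \<open>simp_all add: chain_vec_mult z(2)\<close>)
    from reflexive_imp_double_boundary[OF refl cycles_extensional[OF z(1)] w(2) this]
    have "chain_vec (\<lambda>\<tau>\<in>E. 2 * z \<tau>) \<in> ?B" by blast
    then show ?thesis by (simp add: chain_vec_mult z(2))
  qed
  have "\<exists>g U (V :: 'm set). U \<inter> V = {} \<and> U \<union> V \<subseteq> UNIV \<and> generates_mod g (U \<union> V) ?B ?Z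
    \<and> (\<forall>y\<in>V. 2 *\<^sub>R g y \<in> ?B)
    \<and> (\<forall>m. int_lincomb m g (U \<union> V) \<in> ?B \<longrightarrow> (\<forall>x\<in>U. m x = 0) \<and> (\<forall>y\<in>V. even (m y)))"
    by (rule free_plus_Z2_generators[OF finite B Z BZ f]) (rule tors)
  then obtain g and U V :: "'m set" where disj: "U \<inter> V = {}" and g: "generates_mod g (U \<union> V) ?B ?Z"
    and two: "\<forall>y\<in>V. 2 *\<^sub>R g y \<in> ?B"
    and ind: "\<forall>m. int_lincomb m g (U \<union> V) \<in> ?B \<longrightarrow> (\<forall>x\<in>U. m x = 0) \<and> (\<forall>y\<in>V. even (m y))"
    by (elim exE conjE) (rule that)
  obtain s where s: "bij_betw s {..<card U} U"
    using ex_bij_betw_nat_finite[of U] by (auto simp: atLeast0LessThan)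
  obtain t where t: "bij_betw t {..<card V} V"
    using ex_bij_betw_nat_finite[of V] by (auto simp: atLeast0LessThan)
  \<comment> \<open>The generators obtained so far are vectors; each is replaced by a cycle with
    that coordinate vector.\<close>
  define lift where "lift u = inv_into (cycles \<Delta> (d - 1)) chain_vec (g u)" for u
  have lift: "lift u \<in> cycles \<Delta> (d - 1)" "chain_vec (lift u) = g u" if "u \<in> U \<union> V" for u
  proof -
    have "g u \<in> ?Z" using g that by (auto simp: generates_mod_def)
    then show "lift u \<in> cycles \<Delta> (d - 1)" "chain_vec (lift u) = g u"
      by (auto simp: lift_def inv_into_into f_inv_into_f)
  qed
  have sU: "s i \<in> U" if "i < card U" for i using s that by (auto simp: bij_betw_def)
  have tV: "t i \<in> V" if "i < card V" for i using t that by (auto simp: bij_betw_def)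
  let ?comb = "generator_comb (d - 1) (card U) (card V) (\<lambda>i. lift (s i)) (\<lambda>i. lift (t i))"
  have comb: "chain_vec (?comb (\<lambda>i. m (s i)) (\<lambda>i. m (t i))) = int_lincomb m g (U \<union> V)" for m
  proof -
    have "chain_vec (?comb (\<lambda>i. m (s i)) (\<lambda>i. m (t i))) $ k = int_lincomb m g (U \<union> V) $ k" for k
    proof -
      have "chain_vec (?comb (\<lambda>i. m (s i)) (\<lambda>i. m (t i))) $ k
        = (\<Sum>i<card U. of_int (m (s i)) * chain_vec (lift (s i)) $ k)
          + (\<Sum>i<card V. of_int (m (t i)) * chain_vec (lift (t i)) $ k)"
        using row_face by (simp add: chain_vec_def generator_comb_def)
      also have "\<dots> = (\<Sum>u\<in>U. of_int (m u) * chain_vec (lift u) $ k) + (\<Sum>u\<in>V. of_int (m u) * chain_vec (lift u) $ k)"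
        using sum.reindex_bij_betw[OF s, of "\<lambda>u. of_int (m u) * chain_vec (lift u) $ k"]
          sum.reindex_bij_betw[OF t, of "\<lambda>u. of_int (m u) * chain_vec (lift u) $ k"] by simp
      also have "\<dots> = (\<Sum>u\<in>U. of_int (m u) * g u $ k) + (\<Sum>u\<in>V. of_int (m u) * g u $ k)"
        using lift(2) by simp
      also have "\<dots> = int_lincomb m g (U \<union> V) $ k"
        using disj by (simp add: int_lincomb_def sum.union_disjoint)
      finally show ?thesis .
    qed
    then show ?thesis by (simp add: vec_eq_iff)
  qed
  have ext: "?comb p q \<in> E \<rightarrow>\<^sub>E UNIV" for p q by (simp add: generator_comb_def)
  have "free_plus_Z2_basis (d - 1) (card U) (card V) (\<lambda>i. lift (s i)) (\<lambda>i. lift (t i))"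
    unfolding free_plus_Z2_basis_def
  proof (intro conjI allI impI ballI)
    fix i assume i: "i < card V"
    show "(\<lambda>\<tau>\<in>E. 2 * lift (t i) \<tau>) \<in> boundaries \<Delta> (d - 1)"
      by (rule BD) (use two tV[OF i] lift(2) in \<open>simp_all add: chain_vec_mult\<close>)
  next
    fix z assume z: "z \<in> cycles \<Delta> (d - 1)"
    then obtain m where m: "chain_vec z - int_lincomb m g (U \<union> V) \<in> ?B"
      using g unfolding generates_mod_def by blast
    have "chain_vec (\<lambda>\<tau>\<in>E. z \<tau> - ?comb (\<lambda>i. m (s i)) (\<lambda>i. m (t i)) \<tau>) \<in> ?B"
      unfolding chain_vec_diff comb by (rule m)
    then have "(\<lambda>\<tau>\<in>E. z \<tau> - ?comb (\<lambda>i. m (s i)) (\<lambda>i. m (t i)) \<tau>) \<in> boundaries \<Delta> (d - 1)"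
      by (rule BD) simp
    then show "\<exists>p q. (\<lambda>\<tau>\<in>E. z \<tau> - ?comb p q \<tau>) \<in> boundaries \<Delta> (d - 1)" by blast
  next
    fix p q assume pq: "?comb p q \<in> boundaries \<Delta> (d - 1)"
    \<comment> \<open>Glues \<open>p\<close> and \<open>q\<close> into one coefficient function on
      \<open>U \<union> V\<close>, consistently because the two sets are disjoint.\<close>
    define m where "m u = (if u \<in> U then p (inv_into {..<card U} s u) else q (inv_into {..<card V} t u))" for u
    have ms: "m (s i) = p i" if "i < card U" for i
      using bij_betw_inv_into_left[OF s, of i] sU[OF that] that by (simp add: m_def)
    have mt: "m (t i) = q i" if "i < card V" for i
    proof -
      have "t i \<notin> U" using tV[OF that] disj by blast
      then show ?thesis using bij_betw_inv_into_left[OF t, of i] that by (simp add: m_def)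
    qed
    have "?comb p q = ?comb (\<lambda>i. m (s i)) (\<lambda>i. m (t i))" using ms mt by (simp add: generator_comb_def)
    then have "int_lincomb m g (U \<union> V) \<in> ?B" using pq comb[of m] by (metis imageI)
    then have m: "\<forall>x\<in>U. m x = 0" "\<forall>y\<in>V. even (m y)" using ind by blast+
    show "p i = 0" if "i < card U" for i using m(1) ms sU that by metis
    show "even (q i)" if "i < card V" for i using m(2) mt tV that by metis
  qed (use lift(1) sU tV in auto)
  then show thesis by (rule that)
qed

text \<open>If \<open>2 y i\<close> is the boundary of \<open>c\<close>, subtracting the boundary of
  \<open>c div 2\<close> from \<open>y i\<close> leaves the boundary of
  \<open>(c mod 2) / 2\<close>, whose entries are 0 and 1/2. The even support expresses that the sum
  of these entries is integral.\<close>

lemma reflexive_imp_half_lifts: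
  assumes refl: "reflexive (symmetric_homology_polytope \<rho> \<Delta> :: (real ^ 'm) set)"
    and basis: "free_plus_Z2_basis (d - 1) l r x y" and i: "i < r"
  shows "\<exists>(v :: nat set \<Rightarrow> real) z. v \<in> D \<rightarrow>\<^sub>E {1/2, -1/2, 0} \<and> (\<exists>\<sigma>\<in>D. v \<sigma> \<noteq> 0) \<and> even (card {\<sigma> \<in> D. v \<sigma> \<noteq> 0})
    \<and> z \<in> carrier (chain_group \<Delta> (d - 1)) \<and> (\<forall>\<tau>\<in>E. boundary \<Delta> d v \<tau> = real_of_int (z \<tau>))
    \<and> homology_class \<Delta> (d - 1) z = homology_class \<Delta> (d - 1) (y i)"
proof -
  have y: "y i \<in> cycles \<Delta> (d - 1)" "(\<lambda>\<tau>\<in>E. 2 * y i \<tau>) \<in> boundaries \<Delta> (d - 1)"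
    using basis i by (auto simp: free_plus_Z2_basis_def)
  then obtain c where c: "(\<lambda>\<tau>\<in>E. 2 * y i \<tau>) = boundary \<Delta> d c" by (auto simp: boundaries_E)
  define b where "b = boundary \<Delta> d (\<lambda>\<sigma>. c \<sigma> div 2)"
  have b: "b \<in> boundaries \<Delta> (d - 1)" by (simp add: b_def boundaries_E)
  then have bc: "b \<in> cycles \<Delta> (d - 1)" using boundaries_subset_cycles by blast
  define z where "z = (\<lambda>\<tau>\<in>E. y i \<tau> - b \<tau>)"
  define v where "v = (\<lambda>\<sigma>\<in>D. if odd (c \<sigma>) then 1/2 else 0 :: real)"
  have zc: "z \<in> cycles \<Delta> (d - 1)" unfolding z_def by (rule cycles_diff[OF y(1) bc])
  have cls: "homology_class \<Delta> (d - 1) z = homology_class \<Delta> (d - 1) (y i)"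
  proof -
    have "(\<lambda>\<tau>\<in>E. z \<tau> - y i \<tau>) = (\<lambda>\<tau>\<in>E. - 1 * b \<tau>)" by (auto simp: z_def fun_eq_iff)
    then show ?thesis using homology_class_eq_iff[OF zc y(1)] boundaries_mult[OF b, of "-1"] by simp
  qed
  have bz: "boundary \<Delta> d v \<tau> = real_of_int (z \<tau>)" if \<tau>: "\<tau> \<in> E" for \<tau>
  proof -
    have "2 * y i \<tau> = (\<Sum>\<sigma>\<in>D. incidence \<tau> \<sigma> * c \<sigma>)"
      using fun_cong[OF c, of \<tau>] \<tau> by (simp add: boundary_def)
    then have "2 * z \<tau> = (\<Sum>\<sigma>\<in>D. incidence \<tau> \<sigma> * c \<sigma>) - 2 * (\<Sum>\<sigma>\<in>D. incidence \<tau> \<sigma> * (c \<sigma> div 2))"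
      using \<tau> by (simp add: z_def b_def boundary_def)
    also have "\<dots> = (\<Sum>\<sigma>\<in>D. incidence \<tau> \<sigma> * (c \<sigma> mod 2))"
      by (simp add: sum_distrib_left minus_mult_div_eq_mod[symmetric] algebra_simps flip: sum_subtractf)
    finally have "real_of_int (2 * z \<tau>) = (\<Sum>\<sigma>\<in>D. of_int (incidence \<tau> \<sigma>) * of_int (c \<sigma> mod 2))" by simp
    also have "\<dots> = (\<Sum>\<sigma>\<in>D. 2 * (of_int (incidence \<tau> \<sigma>) * v \<sigma>))"
      by (intro sum.cong refl) (auto simp: v_def odd_iff_mod_2_eq_one)
    also have "\<dots> = 2 * boundary \<Delta> d v \<tau>" using \<tau> by (simp add: boundary_def sum_distrib_left)
    finally show ?thesis by simp
  qed
  have cv: "chain_vec z = column_comb v" using bz by (intro boundary_chain_vec) blast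
  have supp: "{\<sigma> \<in> D. v \<sigma> \<noteq> 0} = {\<sigma> \<in> D. odd (c \<sigma>)}" by (auto simp: v_def)
  have "(\<Sum>\<sigma>\<in>D. v \<sigma>) \<in> \<int>"
    by (rule reflexive_imp_half_integral(1)[OF refl]) (simp add: cv[symmetric] integral_chain_vec)
  moreover have "(\<Sum>\<sigma>\<in>D. v \<sigma>) = of_int (int (card {\<sigma> \<in> D. v \<sigma> \<noteq> 0})) / 2"
  proof -
    have "(\<Sum>\<sigma>\<in>D. v \<sigma>) = (\<Sum>\<sigma>\<in>{\<sigma> \<in> D. odd (c \<sigma>)}. 1/2)"
      using finite_faces by (intro sum.mono_neutral_cong_right) (auto simp: v_def)
    then show ?thesis unfolding supp by simp
  qed
  ultimately have "even (card {\<sigma> \<in> D. v \<sigma> \<noteq> 0})" using half_int_in_Ints_iff[of "int (card {\<sigma> \<in> D. v \<sigma> \<noteq> 0})"] by simp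
  \<comment> \<open>If \<open>v\<close> vanished, \<open>y i\<close> would bound; but as a
    combination of the basis it has the odd coefficient 1.\<close>
  moreover have "\<exists>\<sigma>\<in>D. v \<sigma> \<noteq> 0"
  proof (rule ccontr)
    assume "\<not> ?thesis"
    then have "column_comb v = column_comb (\<lambda>\<sigma>. of_int 0)" by (intro column_comb_cong) simp
    then have "\<exists>c :: nat set \<Rightarrow> int. chain_vec z = column_comb (\<lambda>\<sigma>. of_int (c \<sigma>))"
      unfolding cv by (intro exI[of _ "\<lambda>_. 0"])
    then have "z \<in> boundaries \<Delta> (d - 1)"
      using boundaries_chain_vec_iff[OF cycles_extensional[OF zc]] by blast
    then have "y i \<in> boundaries \<Delta> (d - 1)" using cls homology_class_eq_boundaries_iff zc y(1) by metis
    moreover have "generator_comb (d - 1) l r x y (\<lambda>_. 0) (\<lambda>k. if k = i then 1 else 0) = y i"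
    proof
      fix \<tau>
      show "generator_comb (d - 1) l r x y (\<lambda>_. 0) (\<lambda>k. if k = i then 1 else 0) \<tau> = y i \<tau>"
        using i cycles_extensional[OF y(1)]
        by (auto simp: generator_comb_def PiE_def extensional_def if_distrib[of "\<lambda>c. c * _"] cong: if_cong)
    qed
    ultimately have "\<forall>k<r. even (if k = i then 1 else 0 :: int)"
      using basis unfolding free_plus_Z2_basis_def by metis
    then show False using i by auto
  qed
  moreover have "v \<in> D \<rightarrow>\<^sub>E {1/2, -1/2, 0}" by (auto simp: v_def)
  moreover have "z \<in> carrier (chain_group \<Delta> (d - 1))" using cycles_extensional[OF zc] by simp
  ultimately show ?thesis using bz cls by blast
qed

end

text \<open>Every nonzero entry is congruent to 1/2 modulo the integers, so an even number of them
  sums to an integer.\<close>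

lemma sum_half_integral:
  fixes v :: "'b \<Rightarrow> real"
  assumes "finite D" "\<And>\<sigma>. \<sigma> \<in> D \<Longrightarrow> v \<sigma> \<in> {1/2, -1/2, 0}" "even (card {\<sigma> \<in> D. v \<sigma> \<noteq> 0})"
  shows "(\<Sum>\<sigma>\<in>D. v \<sigma>) \<in> \<int>"
proof -
  let ?S = "{\<sigma> \<in> D. v \<sigma> \<noteq> 0}"
  have "(\<Sum>\<sigma>\<in>D. v \<sigma>) = (\<Sum>\<sigma>\<in>?S. v \<sigma>)"
    using assms(1) by (intro sum.mono_neutral_right) auto
  also have "\<dots> = (\<Sum>\<sigma>\<in>?S. (v \<sigma> - 1/2) + 1/2)" by simp
  also have "\<dots> = (\<Sum>\<sigma>\<in>?S. v \<sigma> - 1/2) + of_int (int (card ?S)) / 2"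
    unfolding sum.distrib by simp
  also have "\<dots> \<in> \<int>"
  proof (rule Ints_add)
    show "(\<Sum>\<sigma>\<in>?S. v \<sigma> - 1/2) \<in> \<int>"
    proof (rule Ints_sum)
      fix \<sigma> assume "\<sigma> \<in> ?S"
      then have "v \<sigma> - 1/2 = 0 \<or> v \<sigma> - 1/2 = -1" using assms(2)[of \<sigma>] by auto
      then show "v \<sigma> - 1/2 \<in> \<int>" by (metis Ints_0 Ints_1 Ints_minus)
    qed
    show "of_int (int (card ?S)) / 2 \<in> (\<int> :: real set)" unfolding half_int_in_Ints_iff using assms(3) by simp
  qed
  finally show ?thesis .
qed

theorem theorem6p7:
  fixes n d s :: nat and \<Delta> :: "nat set set" and \<rho> :: "'m::finite \<Rightarrow> nat set"
  assumes "1 \<le> d"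
    and "abstract_simplicial_complex n \<Delta>"
    and "complex_dim \<Delta> = int d"
    and "card (faces \<Delta> d) = s"
    and "trivial_group (homology \<Delta> d)"
    and "bij_betw \<rho> UNIV (faces \<Delta> (d - 1))"
  shows "reflexive (symmetric_homology_polytope \<rho> \<Delta>) \<longleftrightarrow>
      trivial_group (homology \<Delta> (d - 1))
    \<or> (even d \<and> (\<exists>l r. homology \<Delta> (d - 1) \<cong> free_plus_Z2 l r))
    \<or> (odd d \<and> (\<exists>l r. homology \<Delta> (d - 1) \<cong> free_plus_Z2 l r \<and>
         (\<exists>(v :: nat \<Rightarrow> nat set \<Rightarrow> real) (z :: nat \<Rightarrow> nat set \<Rightarrow> int).
            (\<forall>i<r. v i \<in> faces \<Delta> d \<rightarrow>\<^sub>E {1/2, -1/2, 0}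
                 \<and> (\<exists>\<sigma>\<in>faces \<Delta> d. v i \<sigma> \<noteq> 0)
                 \<and> even (card {\<sigma> \<in> faces \<Delta> d. v i \<sigma> \<noteq> 0})
                 \<and> z i \<in> carrier (chain_group \<Delta> (d - 1))
                 \<and> (\<forall>\<tau>\<in>faces \<Delta> (d - 1). boundary \<Delta> d (v i) \<tau> = real_of_int (z i \<tau>)))
          \<and> generate (homology \<Delta> (d - 1)) ((\<lambda>i. homology_class \<Delta> (d - 1) (z i)) ` {..<r})
              = torsion_part (homology \<Delta> (d - 1)))))"
proof -
  interpret top_acyclic_complex n \<Delta> d \<rho>
    using assms by unfold_locales auto
  let ?P = "symmetric_homology_polytope \<rho> \<Delta> :: (real ^ 'm) set"
  let ?lifts = "\<lambda>l r (v :: nat \<Rightarrow> nat set \<Rightarrow> real) (z :: nat \<Rightarrow> nat set \<Rightarrow> int).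
    (\<forall>i<r. v i \<in> faces \<Delta> d \<rightarrow>\<^sub>E {1/2, -1/2, 0}
       \<and> (\<exists>\<sigma>\<in>faces \<Delta> d. v i \<sigma> \<noteq> 0)
       \<and> even (card {\<sigma> \<in> faces \<Delta> d. v i \<sigma> \<noteq> 0})
       \<and> z i \<in> carrier (chain_group \<Delta> (d - 1))
       \<and> (\<forall>\<tau>\<in>faces \<Delta> (d - 1). boundary \<Delta> d (v i) \<tau> = real_of_int (z i \<tau>)))
    \<and> generate (homology \<Delta> (d - 1)) ((\<lambda>i. homology_class \<Delta> (d - 1) (z i)) ` {..<r})
        = torsion_part (homology \<Delta> (d - 1))"
  show ?thesis
  proof (intro iffI)
    assume refl: "reflexive ?P"
    \<comment> \<open>One basis serves both parities of \<open>d\<close>: it yields the isomorphism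
      and the lifts together.\<close>
    obtain l r x y where basis: "free_plus_Z2_basis (d - 1) l r x y"
      using reflexive_imp_basis[OF refl] .
    note iso = homology_iso_free_plus_Z2[OF basis]
    \<comment> \<open>Packs what is required of one pair \<open>v\<close>, \<open>z\<close>, so that
      all pairs can be chosen at once; the last clause lets the classes of the \<open>z i\<close>
      replace those of the \<open>y i\<close> as generators.\<close>
    define good where "good i v z \<longleftrightarrow> v \<in> D \<rightarrow>\<^sub>E {1/2, -1/2, 0} \<and> (\<exists>\<sigma>\<in>D. v \<sigma> \<noteq> 0)
        \<and> even (card {\<sigma> \<in> D. v \<sigma> \<noteq> 0}) \<and> z \<in> carrier (chain_group \<Delta> (d - 1))
        \<and> (\<forall>\<tau>\<in>E. boundary \<Delta> d v \<tau> = real_of_int (z \<tau>))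
        \<and> homology_class \<Delta> (d - 1) z = homology_class \<Delta> (d - 1) (y i)"
      for i and v :: "nat set \<Rightarrow> real" and z
    have "\<forall>i<r. \<exists>v z. good i v z"
      unfolding good_def using reflexive_imp_half_lifts[OF refl basis] by blast
    then obtain v z where "\<forall>i<r. good i (v i) (z i)" by metis
    note vz = this[unfolded good_def]
    from vz have "(\<lambda>i. homology_class \<Delta> (d - 1) (z i)) ` {..<r} = (\<lambda>i. homology_class \<Delta> (d - 1) (y i)) ` {..<r}"
      by (intro image_cong) auto
    then have "?lifts l r v z" using vz generate_torsion_generators[OF basis] by simp
    then show "trivial_group H \<or> (even d \<and> (\<exists>l r. H \<cong> free_plus_Z2 l r))
        \<or> (odd d \<and> (\<exists>l r. H \<cong> free_plus_Z2 l r \<and> (\<exists>v z. ?lifts l r v z)))"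
      using iso by blast
  next
    assume "trivial_group H \<or> (even d \<and> (\<exists>l r. H \<cong> free_plus_Z2 l r))
        \<or> (odd d \<and> (\<exists>l r. H \<cong> free_plus_Z2 l r \<and> (\<exists>v z. ?lifts l r v z)))"
    then consider "trivial_group H" | l r where "even d" "H \<cong> free_plus_Z2 l r"
      | l r v z where "H \<cong> free_plus_Z2 l r" "?lifts l r v z" by blast
    then show "reflexive ?P"
    proof cases
      case 1
      then show ?thesis by (rule trivial_homology_imp_reflexive)
    next
      case 2
      then show ?thesis by (rule even_dim_imp_reflexive)
    next
      case (3 l r v z)
      show ?thesis
      proof (rule torsion_generators_imp_reflexive[OF 3(1)])
        show "generate H ((\<lambda>i. homology_class \<Delta> (d - 1) (z i)) ` {..<r}) = torsion_part H"
          using 3(2) by blast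
        fix i assume i: "i < r"
        then have vi: "v i \<in> D \<rightarrow>\<^sub>E {1/2, -1/2, 0}" "even (card {\<sigma> \<in> D. v i \<sigma> \<noteq> 0})"
          "z i \<in> carrier (chain_group \<Delta> (d - 1))" "\<forall>\<tau>\<in>E. boundary \<Delta> d (v i) \<tau> = real_of_int (z i \<tau>)"
          using 3(2) by blast+
        show "z i \<in> E \<rightarrow>\<^sub>E UNIV" using vi(3) by simp
        show "chain_vec (z i) = column_comb (v i)" using vi(4) by (rule boundary_chain_vec)
        show "(\<Sum>\<sigma>\<in>D. v i \<sigma>) \<in> \<int>"
          by (rule sum_half_integral[OF finite_faces PiE_mem[OF vi(1)] vi(2)])
      qed
    qed
  qed
qed

end
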